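(* Let $\Gamma_1,\Gamma_2$ be non-empty sets of cycles such that the length $\gamma^1$ of a shortest cycle in $\Gamma_1$ and the length $\gamma^2$ of a shortest cycle in $\Gamma_2$ are both even. Then $$R(\Gamma_1,\Gamma_2)=\begin{cases}\mathfrak m(\Gamma_1,\Gamma_2)+1 & \text{if } (\Gamma_1,\Gamma_2)\in\mathscr{C},\\ \mathfrak m(\Gamma_1,\Gamma_2) & \text{otherwise,}\end{cases}$$ where $\mathscr{C}$ is the set of all pairs $(\Gamma_1,\Gamma_2)$ of non-empty sets of cycles such that ($C_3\in\Gamma_1\cap\Gamma_2$ or $C_4\in\Gamma_1\cap\Gamma_2$) and ($C_3\notin\Gamma_1\cup\Gamma_2$ or $C_5\notin\Gamma_1\cup\Gamma_2$).
   Context: All graphs are finite, simple and undirected; $C_k$ ($k\ge 3$) is the cycle of length $k$. A red-blue graph is a complete graph with each edge coloured red or blue; its red (blue) subgraph is the spanning subgraph formed by all red (blue) edges. It is called red (blue) bipartite if its red (blue) subgraph is bipartite. For non-empty sets $\mathcal G_1,\mathcal G_2$ of non-empty graphs: - $R(\mathcal G_1,\mathcal G_2)$ is the least positive integer $N$ such that each red-blue graph on $N$ vertices contains a red subgraph from $\mathcal G_1$ or a blue subgraph from $\mathcal G_2$. - $R_{\mathrm{red}}(\mathcal G_1,\mathcal G_2)$ (resp. $R_{\mathrm{blue}}(\mathcal G_1,\mathcal G_2)$) is the least positive integer $N$ such that each red bipartite (resp. blue bipartite) red-blue graph on $N$ vertices contains a red subgraph from $\mathcal G_1$ or a blue subgraph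 from $\mathcal G_2$. For $i\in\{1,2\}$, $\gamma^i=\min\{k\mid C_k\in\Gamma_i\}$ and $\gamma_e^i=\min\{k \text{ even}\mid C_k\in\Gamma_i\}$, with $\gamma_e^i=\infty$ if $\Gamma_i$ contains no even cycle. $\mathfrak m(\Gamma_1,\Gamma_2)=\max\big(R_{\mathrm{red}}(\Gamma_1,\Gamma_2),R_{\mathrm{blue}}(\Gamma_1,\Gamma_2)\big)$; equivalently, $\mathfrak m(\Gamma_1,\Gamma_2)=\max\big(5,\min(\gamma^2+\gamma_e^1/2-1,\,2\gamma^2-1),\min(\gamma^1+\gamma_e^2/2-1,\,2\gamma^1-1)\big)$. *)

theory Defs
  imports "HOL-Library.Ramsey"
begin

record 'a graph =
  verts :: "'a set"
  edges :: "'a set set"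

definition bipartite :: "'a graph \<Rightarrow> bool" where
  "bipartite G \<longleftrightarrow>
     (\<exists>A B. A \<union> B = verts G \<and> A \<inter> B = {} \<and> (\<forall>e\<in>edges G. \<exists>a\<in>A. \<exists>b\<in>B. e = {a, b}))"

text \<open>Subgraph containment up to isomorphism; the copy of \<open>H\<close> need not be induced.\<close>

definition contains_copy :: "'a graph \<Rightarrow> 'b graph \<Rightarrow> bool" where
  "contains_copy G H \<longleftrightarrow>
     (\<exists>f. inj_on f (verts H) \<and> f ` verts H \<subseteq> verts G \<and> (\<forall>e\<in>edges H. f ` e \<in> edges G))"

datatype colour = Red | Blue

text \<open>A complete graph on \<open>points\<close> with coloured edges. Only the values of \<open>edge_colour\<close> on the
  two-element subsets of \<open>points\<close> matter.\<close>

record 'a red_blue_graph =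
  points :: "'a set"
  edge_colour :: "'a set \<Rightarrow> colour"

definition mono_subgraph :: "colour \<Rightarrow> 'a red_blue_graph \<Rightarrow> 'a graph" where
  "mono_subgraph c K = \<lparr>verts = points K, edges = {e \<in> nsets (points K) 2. edge_colour K e = c}\<rparr>"

abbreviation "red_subgraph \<equiv> mono_subgraph Red"
abbreviation "blue_subgraph \<equiv> mono_subgraph Blue"

definition red_bipartite :: "'a red_blue_graph \<Rightarrow> bool" where
  "red_bipartite K \<longleftrightarrow> bipartite (red_subgraph K)"

definition blue_bipartite :: "'a red_blue_graph \<Rightarrow> bool" where
  "blue_bipartite K \<longleftrightarrow> bipartite (blue_subgraph K)"

text \<open>The least positive \<open>N\<close> such that every red-blue graph on \<open>N\<close> vertices with property \<open>P\<close>
  contains a red graph from \<open>\<G>\<^sub>1\<close> or a blue graph from \<open>\<G>\<^sub>2\<close>. For non-empty sets of finite simple graphs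
  such an \<open>N\<close> exists by Ramsey's theorem. Using natural numbers as vertices loses no generality,
  since all graphs are finite.\<close>

definition ramsey_within ::
  "(nat red_blue_graph \<Rightarrow> bool) \<Rightarrow> nat graph set \<Rightarrow> nat graph set \<Rightarrow> nat" where
  "ramsey_within P \<G>\<^sub>1 \<G>\<^sub>2 =
     (LEAST N. 0 < N \<and>
        (\<forall>K. finite (points K) \<and> card (points K) = N \<and> P K \<longrightarrow>
           (\<exists>H\<in>\<G>\<^sub>1. contains_copy (red_subgraph K) H) \<or>
           (\<exists>H\<in>\<G>\<^sub>2. contains_copy (blue_subgraph K) H)))"

definition ramsey :: "nat graph set \<Rightarrow> nat graph set \<Rightarrow> nat" where
  "ramsey = ramsey_within (\<lambda>_. True)"

definition ramsey_red :: "nat graph set \<Rightarrow> nat graph set \<Rightarrow> nat" where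
  "ramsey_red = ramsey_within red_bipartite"

definition ramsey_blue :: "nat graph set \<Rightarrow> nat graph set \<Rightarrow> nat" where
  "ramsey_blue = ramsey_within blue_bipartite"

definition \<mm> :: "nat graph set \<Rightarrow> nat graph set \<Rightarrow> nat" where
  "\<mm> \<Gamma>\<^sub>1 \<Gamma>\<^sub>2 = max (ramsey_red \<Gamma>\<^sub>1 \<Gamma>\<^sub>2) (ramsey_blue \<Gamma>\<^sub>1 \<Gamma>\<^sub>2)"

definition cycle_graph :: "nat \<Rightarrow> nat graph" where
  "cycle_graph k = \<lparr>verts = {..<k}, edges = {{i, Suc i mod k} | i. i < k}\<rparr>"

text \<open>Each cycle is represented by the fixed graph \<open>cycle_graph k\<close>, \<open>k \<ge> 3\<close>, so that isomorphic cycles are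
  identified.\<close>

definition cycles :: "nat graph set" where
  "cycles = {cycle_graph k | k. 3 \<le> k}"

definition shortest_cycle_length :: "nat graph set \<Rightarrow> nat" where
  "shortest_cycle_length \<Gamma> = (LEAST k. 3 \<le> k \<and> cycle_graph k \<in> \<Gamma>)"

definition \<C> :: "(nat graph set \<times> nat graph set) set" where
  "\<C> = {(\<Gamma>\<^sub>1, \<Gamma>\<^sub>2). \<Gamma>\<^sub>1 \<noteq> {} \<and> \<Gamma>\<^sub>1 \<subseteq> cycles \<and> \<Gamma>\<^sub>2 \<noteq> {} \<and> \<Gamma>\<^sub>2 \<subseteq> cycles \<and>
          (cycle_graph 3 \<in> \<Gamma>\<^sub>1 \<inter> \<Gamma>\<^sub>2 \<or> cycle_graph 4 \<in> \<Gamma>\<^sub>1 \<inter> \<Gamma>\<^sub>2) \<and>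
          (cycle_graph 3 \<notin> \<Gamma>\<^sub>1 \<union> \<Gamma>\<^sub>2 \<or> cycle_graph 5 \<notin> \<Gamma>\<^sub>1 \<union> \<Gamma>\<^sub>2)}"

end

theory Submission
  imports Defs "HOL-Library.Multiset"
begin

text \<open>
  Let \<open>2a \<ge> 2k\<close> be the two shortest lengths, \<open>(a, k) \<noteq> (2, 2)\<close>. A red clique on \<open>2a - 1\<close> vertices, with
  \<open>k - 1\<close> further vertices joined to it in blue and to each other in red, is blue bipartite and shows
  that \<open>\<mm>\<close> is at least \<open>2a + k - 1\<close>. It thus suffices that every red-blue graph on \<open>2a + k - 1\<close> vertices
  has a red \<open>C\<^sub>2\<^sub>a\<close> or a blue \<open>C\<^sub>2\<^sub>k\<close>. By induction there is a red cycle \<open>x\<close> of length \<open>2l = 2a - 2\<close>; let \<open>Y\<close>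
  consist of \<open>k + 1\<close> vertices outside it and suppose that there is no red \<open>C\<^sub>2\<^sub>a\<close>. Then red neighbours
  of distinct \<open>y, z \<in> Y\<close> follow each other on \<open>x\<close> at most once in either order, and insertion of
  vertices of \<open>Y\<close> into edges of \<open>x\<close> is severely limited. Hence two vertices of \<open>Y\<close> have at least \<open>l - 1\<close>
  common blue neighbours on \<open>x\<close>, and at least \<open>l\<close> if they are joined in red, while three vertices cannot
  share the same \<open>l - 1\<close> pairwise common neighbours. A blue \<open>C\<^sub>2\<^sub>k\<close> therefore arises by zigzagging
  between \<open>Y\<close> and \<open>x\<close>, with the connecting vertices given by a system of distinct representatives;
  in the tight cases it also uses two blue edges inside \<open>Y\<close>.
\<close>

section \<open>Cycles of a relation and systems of distinct representatives\<close>

text \<open>Cycles are taken in a relation rather than in a graph, so that blue is the negation of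
  red and the colours can be exchanged.\<close>

definition has_cycle :: "('a \<Rightarrow> 'a \<Rightarrow> bool) \<Rightarrow> 'a set \<Rightarrow> nat \<Rightarrow> bool" where
  "has_cycle P V k \<longleftrightarrow>
     (\<exists>xs. length xs = k \<and> set xs \<subseteq> V \<and> distinct xs \<and> successively P xs \<and> P (last xs) (hd xs))"

lemma has_cycleI:
  "length xs = k \<Longrightarrow> set xs \<subseteq> V \<Longrightarrow> distinct xs \<Longrightarrow> successively P xs \<Longrightarrow> P (last xs) (hd xs)
   \<Longrightarrow> has_cycle P V k"
  unfolding has_cycle_def by blast

lemma has_cycle_mono: "has_cycle P V k \<Longrightarrow> V \<subseteq> V' \<Longrightarrow> has_cycle P V' k"
  unfolding has_cycle_def by blast

text \<open>A list, because equal sets at different positions still need different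
  representatives.\<close>

definition sdr :: "'a set list \<Rightarrow> bool" where
  "sdr As \<longleftrightarrow> (\<exists>ws. distinct ws \<and> list_all2 (\<in>) ws As)"

lemma sdr_mset_eq:
  fixes As Bs :: "'a set list"
  assumes "mset As = mset Bs" "sdr As"
  shows "sdr Bs"
proof -
  obtain ws where ws: "distinct ws" "list_all2 (\<in>) ws As"
    using assms by (auto simp: sdr_def)
  have "list_all2 (\<lambda>A w. w \<in> A) As ws"
    using ws(2) by (simp add: list_all2_conv_all_nth)
  then obtain vs where "list_all2 (\<lambda>A w. w \<in> A) Bs vs" "mset vs = mset ws"
    using list_all2_reorder_left_invariance[OF _ assms(1)[symmetric]] by blast
  then have "list_all2 (\<in>) vs Bs" "mset vs = mset ws"
    by (simp_all add: list_all2_conv_all_nth)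
  then show ?thesis
    using ws mset_eq_imp_distinct_iff unfolding sdr_def by blast
qed

text \<open>Choosing from left to right, only \<open>i\<close> elements are taken when position
  \<open>i\<close> is reached.\<close>

lemma sdr_greedy:
  assumes "\<And>i. i < length As \<Longrightarrow> i < card (As ! i)"
  shows "sdr As"
  using assms
proof (induction As rule: rev_induct)
  case Nil
  then show ?case by (simp add: sdr_def)
next
  case (snoc A As)
  have "i < card (As ! i)" if "i < length As" for i
    using snoc.prems[of i] that by (simp add: nth_append)
  then obtain ws where ws: "distinct ws" "list_all2 (\<in>) ws As"
    using snoc.IH by (auto simp: sdr_def)
  have "card (set ws) < card A"
    using snoc.prems[of "length As"] ws by (auto simp: distinct_card dest: list_all2_lengthD)
  then have "\<not> A \<subseteq> set ws"
    by (metis List.finite_set card_mono leD)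
  then obtain w where "w \<in> A" "w \<notin> set ws" by blast
  then have "distinct (ws @ [w])" "list_all2 (\<in>) (ws @ [w]) (As @ [A])"
    using ws by (auto intro: list_all2_appendI)
  then show ?case unfolding sdr_def by blast
qed

lemma sdr_Cons:
  assumes "x \<in> A" "sdr (map (\<lambda>B. B - {x}) As)"
  shows "sdr (A # As)"
proof -
  obtain ws where "distinct ws" and ws: "list_all2 (\<in>) ws (map (\<lambda>B. B - {x}) As)"
    using assms by (auto simp: sdr_def)
  moreover have "x \<notin> set ws" and "list_all2 (\<in>) ws As"
    using ws by (auto simp: list_all2_conv_all_nth in_set_conv_nth)
  ultimately have "distinct (x # ws)" "list_all2 (\<in>) (x # ws) (A # As)"
    using assms by auto
  then show ?thesis unfolding sdr_def by blast
qed

text \<open>The large set goes last. Each other set has at least \<open>length As - 1\<close>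
  elements, more than are taken when its turn comes.\<close>

lemma sdr_if_one_large:
  assumes "\<And>A. A \<in> set As \<Longrightarrow> length As \<le> Suc (card A)" "B \<in> set As" "length As \<le> card B"
  shows "sdr As"
proof -
  obtain ys zs where "As = ys @ B # zs"
    using split_list[OF assms(2)] by blast
  then obtain Bs where Bs: "mset As = mset (Bs @ [B])"
    by (auto intro: that[of "ys @ zs"])
  then have len: "length As = Suc (length Bs)" and set: "set As = insert B (set Bs)"
    using mset_eq_length[OF Bs] mset_eq_setD[OF Bs] by auto
  have "sdr (Bs @ [B])"
  proof (rule sdr_greedy)
    fix i assume i: "i < length (Bs @ [B])"
    show "i < card ((Bs @ [B]) ! i)"
    proof (cases "i < length Bs")
      case True
      then have "Bs ! i \<in> set As" using set by auto
      from assms(1)[OF this] show ?thesis using True len by (simp add: nth_append)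
    next
      case False
      then show ?thesis using i assms(3) len by (simp add: nth_append)
    qed
  qed
  then show ?thesis using sdr_mset_eq Bs by metis
qed

text \<open>Let an element \<open>x\<close> of \<open>A\<close> outside \<open>B\<close> represent
  \<open>A\<close>. Deleting \<open>x\<close> costs the other sets at most one element and
  \<open>B\<close> none, so \<open>B\<close> is the large set of the shorter list.\<close>

lemma sdr_if_not_subset:
  assumes "\<And>A. A \<in> set As \<Longrightarrow> length As \<le> Suc (card A)" "A \<in> set As" "B \<in> set As" "\<not> A \<subseteq> B"
  shows "sdr As"
proof -
  obtain x where x: "x \<in> A" "x \<notin> B" using assms by blast
  obtain ys zs where "As = ys @ A # zs"
    using split_list[OF assms(2)] by blast
  then obtain Cs where Cs: "mset As = mset (A # Cs)"
    by (auto intro: that[of "ys @ zs"])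
  then have len: "length As = Suc (length Cs)" and set: "set As = insert A (set Cs)"
    using mset_eq_length[OF Cs] mset_eq_setD[OF Cs] by auto
  have B: "B \<in> set Cs" using assms set by auto
  have "sdr (map (\<lambda>C. C - {x}) Cs)"
  proof (rule sdr_if_one_large)
    fix C assume "C \<in> set (map (\<lambda>C. C - {x}) Cs)"
    then obtain C' where "C = C' - {x}" "C' \<in> set Cs" by auto
    then show "length (map (\<lambda>C. C - {x}) Cs) \<le> Suc (card C)"
      using assms(1)[of C'] len set diff_card_le_card_Diff[of "{x}" C'] by auto
  next
    show "B - {x} \<in> set (map (\<lambda>C. C - {x}) Cs)" using B by auto
    show "length (map (\<lambda>C. C - {x}) Cs) \<le> card (B - {x})"
      using x assms(1)[OF assms(3)] len by simp
  qed
  then have "sdr (A # Cs)" using x sdr_Cons by metis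
  then show ?thesis using sdr_mset_eq Cs by metis
qed

text \<open>The borderline of Hall's condition: \<open>n\<close> sets of at least
  \<open>n - 1\<close> elements fail only by being equal and of size \<open>n - 1\<close>. The tight
  cases below exploit this rigidity.\<close>

lemma no_sdr:
  assumes "\<not> sdr As" "\<And>A. A \<in> set As \<Longrightarrow> length As \<le> Suc (card A)" "A \<in> set As" "B \<in> set As"
  shows "A = B" "Suc (card A) = length As"
proof -
  show "A = B" 
    using assms sdr_if_not_subset[of As A B] sdr_if_not_subset[of As B A] by blast
  show "Suc (card A) = length As"
    using assms sdr_if_one_large[of As A] by (metis le_antisym not_less_eq_eq)
qed

section \<open>Zigzag paths\<close>

fun links :: "('a \<Rightarrow> 'a \<Rightarrow> 'b) \<Rightarrow> 'a list \<Rightarrow> 'b list" where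
  "links f (y # z # ys) = f y z # links f (z # ys)"
| "links f _ = []"

lemma length_links [simp]: "length (links f ys) = length ys - 1"
  by (induction f ys rule: links.induct) auto

lemma set_links_distinct:
  assumes "A \<in> set (links f ys)" "distinct ys"
  obtains y z where "y \<in> set ys" "z \<in> set ys" "y \<noteq> z" "A = f y z"
  using assms by (induction f ys rule: links.induct) auto

text \<open>The path alternates between \<open>ys\<close> and the images of \<open>ws\<close>. Only
  its multiset and its ends are recorded, which suffices to check distinctness, count vertices and
  close it up.\<close>

lemma zigzag_path:
  assumes "list_all2 (\<in>) ws (links C ys)" "ys \<noteq> []"
    and "\<And>y z w. w \<in> C y z \<Longrightarrow> P y (x w) \<and> P (x w) z"
  shows "\<exists>ps. mset ps = mset (ys @ map x ws) \<and> ps \<noteq> [] \<and> successively P ps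
           \<and> hd ps = hd ys \<and> last ps = last ys"
  using assms(1,2)
proof (induction ys arbitrary: ws rule: induct_list012)
  case (3 y z ys)
  obtain w vs where ws: "ws = w # vs" "w \<in> C y z" "list_all2 (\<in>) vs (links C (z # ys))"
    using "3.prems" by (auto simp: list_all2_Cons2)
  obtain ps where ps: "mset ps = mset ((z # ys) @ map x vs)" "ps \<noteq> []" "successively P ps"
     "hd ps = z" "last ps = last (z # ys)"
    using "3.IH"(2)[OF ws(3)] by auto
  show ?case
    by (rule exI[of _ "y # x w # ps"])
       (use ps ws assms(3)[of w y z] in \<open>auto simp: successively_Cons\<close>)
qed auto

lemma obtain_list_minus:
  assumes "finite G"
  obtains zs where "distinct zs" "set zs = G - S"
  using finite_distinct_list[of "G - S"] assms by blast

lemma obtain_three: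
  assumes "3 \<le> card G"
  obtains a b c where "{a, b, c} \<subseteq> G" "distinct [a, b, c]"
proof -
  obtain S where "S \<subseteq> G" "card S = 3"
    using obtain_subset_with_card_n[OF assms] by metis
  then show ?thesis using that by (auto simp: card_3_iff)
qed

section \<open>A red cycle that cannot be lengthened by two\<close>

text \<open>The sequence \<open>x\<close> runs round a red cycle of length \<open>2 * l\<close> periodically, so that indices need no
  reduction; sets of indices, however, consist of representatives below \<open>2 * l\<close>.\<close>

locale red_cycle =
  fixes r :: "'a \<Rightarrow> 'a \<Rightarrow> bool" and x :: "nat \<Rightarrow> 'a" and l :: nat and Y :: "'a set"
  assumes sym: "r u v \<Longrightarrow> r v u"
    and l2: "2 \<le> l"
    and x_eq: "x i = x j \<longleftrightarrow> i mod (2 * l) = j mod (2 * l)"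
    and red: "r (x i) (x (Suc i))"
    and xY: "x i \<notin> Y"
    and finite_Y: "finite Y"
    and no_red: "\<not> has_cycle r (range x \<union> Y) (2 * l + 2)"
begin

abbreviation s :: "nat \<Rightarrow> nat" where
  "s i \<equiv> Suc i mod (2 * l)"

lemma x_mod [simp]: "x (i mod (2 * l)) = x i"
  by (simp add: x_eq)

lemma x_add [simp]: "x (i + 2 * l) = x i"
  by (simp add: x_eq)

lemma x_Suc_mod [simp]: "x (Suc (i mod (2 * l))) = x (Suc i)"
  by (simp add: x_eq mod_Suc_eq)

lemma sym_iff: "r u v \<longleftrightarrow> r v u"
  using sym by blast

text \<open>The bound \<open>c\<close> may exceed \<open>2 * l\<close>: by periodicity an arc that
  passes the starting point is still one interval of indices.\<close>

definition seg :: "nat \<Rightarrow> nat \<Rightarrow> 'a list" where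
  "seg a c = map x [a..<c]"

lemma distinct_seg:
  assumes "c \<le> a + 2 * l"
  shows "distinct (seg a c)"
proof -
  have *: "p = q" if "x p = x q" "a \<le> p" "p \<le> q" "q < c" for p q
  proof -
    have "2 * l dvd q - p" using that mod_eq_dvd_iff_nat[of p q "2 * l"] by (simp add: x_eq)
    moreover have "q - p < 2 * l" using that assms by auto
    ultimately show ?thesis using \<open>p \<le> q\<close> by (auto dest: dvd_imp_le)
  qed
  have "inj_on x {a..<c}"
  proof (rule inj_onI)
    fix p q assume "p \<in> {a..<c}" "q \<in> {a..<c}" "x p = x q"
    then show "p = q" using *[of p q] *[of q p] by (cases "p \<le> q") auto
  qed
  then show ?thesis by (simp add: seg_def distinct_map)
qed

lemma length_seg [simp]: "length (seg a c) = c - a"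
  by (simp add: seg_def)

lemma seg_eq_Nil [simp]: "seg a c = [] \<longleftrightarrow> c \<le> a"
  by (auto simp: seg_def)

lemma set_seg: "set (seg a c) \<subseteq> range x"
  by (auto simp: seg_def)

lemma notin_seg [simp]: "y \<in> Y \<Longrightarrow> y \<notin> set (seg a c)"
  using set_seg xY by fastforce

lemma seg_append: "a \<le> b \<Longrightarrow> b \<le> c \<Longrightarrow> seg a b @ seg b c = seg a c"
  unfolding seg_def by (metis le_iff_add map_append upt_add_eq_append)

lemma successively_seg [simp]: "successively r (seg a c)"
proof (induction c)
  case (Suc c)
  show ?case
  proof (cases "a < c")
    case True
    then have "r (x (c - 1)) (x c)" using red[of "c - 1"] by simp
    then show ?thesis using Suc True by (auto simp: seg_def successively_append_iff last_map)
  qed (auto simp: seg_def)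
qed (simp add: seg_def)

lemma successively_seg_sym [simp]: "successively (\<lambda>u v. r v u) (seg a c)"
  using successively_seg by (rule successively_mono) (rule sym)

lemma hd_seg [simp]: "a < c \<Longrightarrow> hd (seg a c) = x a"
  by (simp add: seg_def hd_map)

lemma last_seg [simp]: "a \<le> c \<Longrightarrow> last (seg a (Suc c)) = x c"
  by (simp add: seg_def last_map)

section \<open>Rerouting the red cycle\<close>

text \<open>The red path through \<open>y\<close> and \<open>z\<close> could replace the cycle edge
  from \<open>x i\<close> to \<open>x (Suc i)\<close>, gaining two vertices.\<close>

lemma no_transit:
  assumes "y \<in> Y" "z \<in> Y" "y \<noteq> z" "r y z" "r y (x i)" "r z (x (Suc i))"
  shows False
proof -
  let ?c = "y # z # seg (Suc i) (Suc (i + 2 * l))"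
  have "has_cycle r (range x \<union> Y) (2 * l + 2)"
  proof (rule has_cycleI[of ?c])
    show "distinct ?c"
      using distinct_seg[of "Suc (i + 2 * l)" "Suc i"] assms by simp
    show "successively r ?c" "r (last ?c) (hd ?c)"
      using assms l2 sym by (auto simp: successively_Cons)
    show "set ?c \<subseteq> range x \<union> Y" using set_seg assms by fastforce
  qed (use l2 in simp)
  then show False using no_red by blast
qed

text \<open>The detour through \<open>y\<close>, \<open>u\<close>, \<open>z\<close> replaces two
  cycle edges: three vertices are gained and \<open>x (Suc i)\<close> is lost.\<close>

lemma no_transit2:
  assumes "y \<in> Y" "u \<in> Y" "z \<in> Y" "y \<noteq> z" "y \<noteq> u" "u \<noteq> z" "r y u" "r u z"
    "r y (x i)" "r z (x (i + 2))"
  shows False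
proof -
  let ?c = "y # u # z # seg (i + 2) (Suc (i + 2 * l))"
  have "has_cycle r (range x \<union> Y) (2 * l + 2)"
  proof (rule has_cycleI[of ?c])
    show "distinct ?c"
      using distinct_seg[of "Suc (i + 2 * l)" "i + 2"] assms by simp
    show "successively r ?c" "r (last ?c) (hd ?c)"
      using assms l2 sym by (auto simp: successively_Cons)
    show "set ?c \<subseteq> range x \<union> Y" using set_seg assms by fastforce
  qed (use l2 in simp)
  then show False using no_red by blast
qed

lemma split_cycle:
  assumes "i < j" "j < i + 2 * l"
  shows "distinct (seg (Suc i) (Suc j) @ seg (Suc j) (Suc (i + 2 * l)))"
  using distinct_seg[of "Suc (i + 2 * l)" "Suc i"] assms
  by (simp add: seg_append del: distinct_append)

text \<open>Insertions into different edges do not interfere and together would lengthen the cycle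
  by two.\<close>

lemma no_two_insertions:
  assumes "y \<in> Y" "z \<in> Y" "y \<noteq> z" "i < 2 * l" "j < 2 * l"
    "r y (x i)" "r y (x (Suc i))" "r z (x j)" "r z (x (Suc j))"
  shows "i = j"
proof -
  have False if "y \<in> Y" "z \<in> Y" "y \<noteq> z" "i < j" "j < i + 2 * l"
    "r y (x i)" "r y (x (Suc i))" "r z (x j)" "r z (x (Suc j))" for y z i j
  proof -
    let ?c = "y # seg (Suc i) (Suc j) @ z # seg (Suc j) (Suc (i + 2 * l))"
    have "has_cycle r (range x \<union> Y) (2 * l + 2)"
    proof (rule has_cycleI[of ?c])
      show "distinct ?c" using split_cycle[of i j] that by auto
      show "successively r ?c" "r (last ?c) (hd ?c)"
        using that sym by (auto simp: successively_Cons successively_append_iff)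
      show "set ?c \<subseteq> range x \<union> Y" using set_seg that by fastforce
    qed (use that in simp)
    then show False using no_red by blast
  qed
  from this[of y z i j] this[of z y j i] assms show ?thesis
    by (cases i j rule: linorder_cases) auto
qed

text \<open>Cut the cycle after \<open>x i\<close> and after \<open>x j\<close>. Then
  \<open>y\<close> joins the ends \<open>x i\<close> and \<open>x j\<close>, and \<open>z\<close>
  joins \<open>x (Suc i)\<close> and \<open>x (Suc j)\<close>; with one arc traversed backwards this
  is a red cycle of length \<open>2 * l + 2\<close>.\<close>

lemma no_crossing:
  assumes "y \<in> Y" "z \<in> Y" "y \<noteq> z" "i < 2 * l" "j < 2 * l"
    "r y (x i)" "r z (x (Suc i))" "r y (x j)" "r z (x (Suc j))"
  shows "i = j"
proof -
  have False if "i < j" "j < i + 2 * l"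
    "r y (x i)" "r z (x (Suc i))" "r y (x j)" "r z (x (Suc j))" for i j
  proof -
    let ?c = "y # rev (seg (Suc j) (Suc (i + 2 * l))) @ z # seg (Suc i) (Suc j)"
    have "has_cycle r (range x \<union> Y) (2 * l + 2)"
    proof (rule has_cycleI[of ?c])
      show "distinct ?c" using split_cycle[of i j] that assms by auto
      show "successively r ?c" "r (last ?c) (hd ?c)"
        using that assms sym
        by (auto simp: successively_Cons successively_append_iff hd_rev last_rev)
      show "set ?c \<subseteq> range x \<union> Y" using set_seg assms by fastforce
    qed (use that in simp)
    then show False using no_red by blast
  qed
  from this[of i j] this[of j i] assms show ?thesis
    by (cases i j rule: linorder_cases) auto
qed

section \<open>Counting common blue neighbours on the cycle\<close>

definition W :: "'a \<Rightarrow> 'a \<Rightarrow> nat set" where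
  "W y z = {i. i < 2 * l \<and> \<not> r y (x i) \<and> \<not> r z (x i)}"

lemma finite_W [simp]: "finite (W y z)"
  by (simp add: W_def)

lemma W_commute: "W y z = W z y"
  by (auto simp: W_def)

lemma s_less [simp]: "s i < 2 * l"
  using l2 by simp

lemma bij_s: "bij_betw s {..<2 * l} {..<2 * l}"
proof -
  have "inj_on s {..<2 * l}"
    by (rule inj_onI) (use l2 in \<open>auto simp: mod_Suc split: if_splits\<close>)
  moreover have "s ` {..<2 * l} \<subseteq> {..<2 * l}" by auto
  ultimately show ?thesis
    by (simp add: bij_betw_def endo_inj_surj)
qed

text \<open>Count the steps from \<open>i\<close> to \<open>s i\<close>. Those starting in
  \<open>U\<close> stay or leave; those ending outside \<open>U\<close>, one for each element there
  as \<open>s\<close> is a bijection, leave \<open>U\<close> or stay outside. The leaving steps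
  cancel.\<close>

lemma card_shift:
  assumes "U \<subseteq> {..<2 * l}"
  shows "card U + card {i. i < 2 * l \<and> i \<notin> U \<and> s i \<notin> U} =
    card ({..<2 * l} - U) + card {i \<in> U. s i \<in> U}"
proof -
  let ?A = "{i \<in> U. s i \<notin> U}" and ?T = "{i \<in> U. s i \<in> U}"
  let ?B = "{i. i < 2 * l \<and> i \<notin> U \<and> s i \<notin> U}"
  have fin: "finite U" using assms finite_subset by blast
  have "card U = card ?T + card ?A"
    using fin by (subst card_Un_disjoint[symmetric]) (auto intro!: arg_cong[where f = card])
  moreover have "card ({..<2 * l} - U) = card ?A + card ?B"
  proof -
    have "{..<2 * l} - U = s ` (?A \<union> ?B)"
    proof (intro equalityI subsetI)
      fix j assume j: "j \<in> {..<2 * l} - U"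
      then obtain i where "i < 2 * l" "j = s i"
        using bij_s by (auto simp: bij_betw_def image_iff set_eq_iff)
      then show "j \<in> s ` (?A \<union> ?B)" using j by auto
    qed (use assms in auto)
    moreover have "inj_on s (?A \<union> ?B)"
      using bij_s assms by (auto simp: bij_betw_def intro: inj_on_subset)
    ultimately have "card ({..<2 * l} - U) = card (?A \<union> ?B)"
      by (simp add: card_image)
    then show ?thesis using fin by (subst (asm) card_Un_disjoint) auto
  qed
  ultimately show ?thesis by simp
qed

text \<open>A lower bound for \<open>card (W y z)\<close> thus follows if there are few gaps, that
  is, consecutive indices both outside \<open>W y z\<close>; consecutive indices inside it improve
  the bound.\<close>

lemma card_shift_W:
  "card {i. i < 2 * l \<and> i \<in> W y z \<and> s i \<in> W y z} + 2 * l =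
    2 * card (W y z) + card {i. i < 2 * l \<and> i \<notin> W y z \<and> s i \<notin> W y z}"
proof -
  let ?U = "{..<2 * l} - W y z"
  have W: "W y z \<subseteq> {..<2 * l}" by (auto simp: W_def)
  have "card {i. i < 2 * l \<and> i \<notin> ?U \<and> s i \<notin> ?U} = card {i. i < 2 * l \<and> i \<in> W y z \<and> s i \<in> W y z}"
    by (rule arg_cong[where f = card]) auto
  moreover have "card {i \<in> ?U. s i \<in> ?U} = card {i. i < 2 * l \<and> i \<notin> W y z \<and> s i \<notin> W y z}"
    by (rule arg_cong[where f = card]) auto
  moreover have "{..<2 * l} - ?U = W y z" using W by auto
  moreover have "card ?U + card (W y z) = 2 * l"
    using W card_mono[OF _ W] by (simp add: card_Diff_subset)
  ultimately show ?thesis using card_shift[of ?U] by auto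
qed

text \<open>Taking \<open>e = 2 * l\<close>, which is not an index, expresses that no vertex of \<open>G\<close> can be inserted.\<close>

definition good :: "nat \<Rightarrow> 'a set \<Rightarrow> bool" where
  "good e G \<longleftrightarrow> G \<subseteq> Y \<and> (\<forall>y\<in>G. \<forall>i<2 * l. r y (x i) \<and> r y (x (Suc i)) \<longrightarrow> i = e)"

lemma good_subset: "good e G \<Longrightarrow> H \<subseteq> G \<Longrightarrow> good e H"
  by (auto simp: good_def)

text \<open>If two different vertices can be inserted, \<open>no_two_insertions\<close> forces all
  insertions of all vertices into one edge. Otherwise at most one vertex \<open>u\<close> can be
  inserted, and it is set aside.\<close>

lemma good_cases:
  obtains e where "good e Y"
  | u i where "u \<in> Y" "i < 2 * l" "r u (x i)" "r u (x (Suc i))" "good (2 * l) (Y - {u})"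
proof (cases "good (2 * l) Y")
  case False
  then obtain u i where u: "u \<in> Y" "i < 2 * l" "r u (x i)" "r u (x (Suc i))"
    by (auto simp: good_def)
  show ?thesis
  proof (cases "good (2 * l) (Y - {u})")
    case False
    then obtain v j where v: "v \<in> Y" "v \<noteq> u" "j < 2 * l" "r v (x j)" "r v (x (Suc j))"
      by (auto simp: good_def)
    have "good i Y"
      unfolding good_def
    proof (intro conjI ballI allI impI)
      fix y k assume "y \<in> Y" "k < 2 * l" "r y (x k) \<and> r y (x (Suc k))"
      then show "k = i"
        using no_two_insertions[of y u k i] no_two_insertions[of y v k j]
          no_two_insertions[of u v i j] u v by (cases "y = u") auto
    qed simp
    then show ?thesis using that by blast
  qed (use that u in blast)
qed (use that in blast)

abbreviation transits :: "'a \<Rightarrow> 'a \<Rightarrow> nat set" where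
  "transits y z \<equiv> {i. i < 2 * l \<and> r y (x i) \<and> r z (x (Suc i))}"

lemma card_transits:
  assumes "y \<in> Y" "z \<in> Y" "y \<noteq> z"
  shows "card (transits y z) \<le> 1"
proof (rule card_le_Suc0_iff_eq[THEN iffD2, folded One_nat_def])
  show "\<forall>i\<in>transits y z. \<forall>j\<in>transits y z. i = j"
    using no_crossing[OF assms] by blast
qed simp

lemma card_exceptional: "card {i. i < 2 * l \<and> i = e} \<le> (if e < 2 * l then 1 else 0)"
proof (cases "e < 2 * l")
  case True
  then have "{i. i < 2 * l \<and> i = e} = {e}" by auto
  then show ?thesis using True by simp
next
  case False
  then have "{i. i < 2 * l \<and> i = e} = {}" by auto
  then show ?thesis by (simp only: card.empty)
qed

text \<open>At a gap both indices are red to \<open>y\<close> or \<open>z\<close>: the same vertex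
  twice gives an insertion, so \<open>i = e\<close>; different vertices give a transit.\<close>

lemma gaps_subset:
  assumes "good e G" "y \<in> G" "z \<in> G"
  shows "{i. i < 2 * l \<and> i \<notin> W y z \<and> s i \<notin> W y z}
    \<subseteq> {i. i < 2 * l \<and> i = e} \<union> (transits y z \<union> transits z y)"
  using assms by (auto simp: W_def good_def)

lemma card_gaps:
  assumes "good e G" "y \<in> G" "z \<in> G" "y \<noteq> z"
  shows "card {i. i < 2 * l \<and> i \<notin> W y z \<and> s i \<notin> W y z} \<le> (if e < 2 * l then 3 else 2)"
proof -
  have Y: "y \<in> Y" "z \<in> Y" using assms by (auto simp: good_def)
  let ?E = "{i. i < 2 * l \<and> i = e}"
  have "card (?E \<union> (transits y z \<union> transits z y)) \<le> card ?E + (1 + 1)"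
    using card_transits[OF Y] card_transits[OF Y(2,1)] assms(4)
    by (intro order.trans[OF card_Un_le] add_mono) auto
  moreover have "card ?E \<le> (if e < 2 * l then 1 else 0)"
    by (rule card_exceptional)
  moreover have "card {i. i < 2 * l \<and> i \<notin> W y z \<and> s i \<notin> W y z} \<le>
      card (?E \<union> (transits y z \<union> transits z y))"
    by (rule card_mono[OF _ gaps_subset[OF assms(1-3)]]) auto
  moreover have "p \<le> (if b then 3 else 2)"
    if "q \<le> m + (1 + 1)" "m \<le> (if b then 1 else 0)" "p \<le> q" for p q m :: nat and b
    using that by (auto split: if_splits)
  ultimately show ?thesis by blast
qed

text \<open>At most three gaps give \<open>2 * l <= 2 * card (W y z) + 3\<close>, and parity
  sharpens the 3 to 2.\<close>

lemma card_W:
  assumes "good e G" "y \<in> G" "z \<in> G" "y \<noteq> z"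
  shows "l \<le> Suc (card (W y z))"
  using card_gaps[OF assms] card_shift_W[of y z] by (auto split: if_splits)

text \<open>A red edge between \<open>y\<close> and \<open>z\<close> excludes transits, so at most
  the gap at \<open>e\<close> remains, and parity absorbs it.\<close>

lemma card_W_red:
  assumes "good e G" "y \<in> G" "z \<in> G" "y \<noteq> z" "r y z"
  shows "l \<le> card (W y z)"
proof -
  have "y \<in> Y" "z \<in> Y" using assms by (auto simp: good_def)
  then have "transits y z \<union> transits z y = {}"
    using no_transit[of y z] no_transit[of z y] assms(4) assms(5) sym by blast
  then have "card {i. i < 2 * l \<and> i \<notin> W y z \<and> s i \<notin> W y z} \<le> card {i. i < 2 * l \<and> i = e}"
    using gaps_subset[OF assms(1-3)] by (intro card_mono) auto
  also have "\<dots> \<le> 1" by (rule order.trans[OF card_exceptional]) simp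
  finally show ?thesis using card_shift_W[of y z] by auto
qed

text \<open>Every index outside the common set is red to at least two of the three vertices, so consecutive
  ones allow an insertion.\<close>

lemma card_W_triple:
  assumes "good e G" "{a, b, c} \<subseteq> G" "W a b = W b c" "W a b = W a c"
  shows "l \<le> card (W a b)"
proof -
  have "{i. i < 2 * l \<and> i \<notin> W a b \<and> s i \<notin> W a b} \<subseteq> {i. i < 2 * l \<and> i = e}"
  proof
    fix i assume i: "i \<in> {i. i < 2 * l \<and> i \<notin> W a b \<and> s i \<notin> W a b}"
    have "\<exists>y\<in>{a, b, c}. r y (x i) \<and> r y (x (Suc i))"
    proof -
      have *: "r a (x j) \<or> r b (x j)" "r b (x j) \<or> r c (x j)" "r a (x j) \<or> r c (x j)"
        if "j < 2 * l" "j \<notin> W a b" for j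
        using that assms(3,4) unfolding W_def by blast+
      show ?thesis using *[of i] *[of "s i"] i by auto
    qed
    then show "i \<in> {i. i < 2 * l \<and> i = e}" using assms(1,2) i by (auto simp: good_def)
  qed
  then have "card {i. i < 2 * l \<and> i \<notin> W a b \<and> s i \<notin> W a b} \<le> card {i. i < 2 * l \<and> i = e}"
    by (intro card_mono) auto
  also have "\<dots> \<le> 1" by (rule order.trans[OF card_exceptional]) simp
  finally show ?thesis using card_shift_W[of a b] by auto
qed

text \<open>Insertions being excluded, every gap is a transit and needs a red neighbour of
  \<open>y\<close>; without gaps \<open>W y z\<close> has at least \<open>l\<close>
  elements.\<close>

lemma red_neighbour_if_card_W_less:
  assumes "good (2 * l) G" "y \<in> G" "z \<in> G" "card (W y z) < l"
  shows "\<exists>i. r y (x i)"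
proof (rule ccontr)
  assume "\<not> ?thesis"
  then have "{i. i < 2 * l \<and> i \<notin> W y z \<and> s i \<notin> W y z} = {}"
    using gaps_subset[OF assms(1-3)] by auto
  then show False
    using card_shift_W[of y z] assms(4) by (simp only: card.empty)
qed

section \<open>Closing zigzags to blue cycles\<close>

abbreviation blue_cycle :: "nat \<Rightarrow> bool" where
  "blue_cycle k \<equiv> has_cycle (\<lambda>u v. \<not> r u v) (range x \<union> Y) (2 * k)"

lemma blue_zigzag:
  assumes "list_all2 (\<in>) ws (links W ys)" "ys \<noteq> []"
  obtains ps where "mset ps = mset (ys @ map x ws)" "ps \<noteq> []" "successively (\<lambda>u v. \<not> r u v) ps"
    "hd ps = hd ys" "last ps = last ys"
  using zigzag_path[OF assms, of "\<lambda>u v. \<not> r u v" x] sym unfolding W_def by blast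

lemma distinct_map_x: "distinct ws \<Longrightarrow> set ws \<subseteq> {..<2 * l} \<Longrightarrow> distinct (map x ws)"
  using distinct_seg[of "2 * l" 0] by (auto simp: seg_def distinct_map atLeast0LessThan intro: inj_on_subset)

lemma sdr_less:
  assumes "list_all2 (\<in>) ws As" "\<And>A. A \<in> set As \<Longrightarrow> A \<subseteq> {..<2 * l}"
  shows "set ws \<subseteq> {..<2 * l}"
  using assms by (fastforce simp: list_all2_conv_all_nth in_set_conv_nth)

lemma W_less: "W y z \<subseteq> {..<2 * l}"
  by (auto simp: W_def)

lemma links_W_less: "A \<in> set (links W ys) \<Longrightarrow> A \<subseteq> {..<2 * l}"
  by (induction W ys rule: links.induct) (auto simp: W_def)

lemma distinct_zigzag:
  assumes "mset ps = mset (ys @ map x ws)" "distinct ys" "set ys \<subseteq> Y" "distinct ws"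
    "set ws \<subseteq> {..<2 * l}"
  shows "distinct ps" "set ps = set ys \<union> x ` set ws" "length ps = length ys + length ws"
proof -
  have "distinct (ys @ map x ws)"
    using assms xY distinct_map_x[of ws] by auto
  then show "distinct ps" using mset_eq_imp_distinct_iff[OF assms(1)] by blast
  show "set ps = set ys \<union> x ` set ws" using mset_eq_setD[OF assms(1)] by simp
  show "length ps = length ys + length ws" using mset_eq_length[OF assms(1)] by simp
qed

lemma blue_cycle_closed:
  assumes "distinct ys" "set ys \<subseteq> Y" "length ys = k" "2 \<le> k"
    "sdr (links W ys @ [W (last ys) (hd ys)])"
  shows "blue_cycle k"
proof -
  obtain vs where vs: "distinct vs" "list_all2 (\<in>) vs (links W ys @ [W (last ys) (hd ys)])"
    using assms(5) by (auto simp: sdr_def)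
  have less: "set vs \<subseteq> {..<2 * l}"
    by (rule sdr_less[OF vs(2)]) (metis W_less links_W_less Un_iff empty_iff empty_set insert_iff list.set(2) set_append)
  obtain ws w where ws: "vs = ws @ [w]" "list_all2 (\<in>) ws (links W ys)" "w \<in> W (last ys) (hd ys)"
    using vs by (auto simp: list_all2_append2 list_all2_Cons2)
  obtain ps where ps: "mset ps = mset (ys @ map x ws)" "ps \<noteq> []"
    "successively (\<lambda>u v. \<not> r u v) ps" "hd ps = hd ys" "last ps = last ys"
    using blue_zigzag[OF ws(2)] assms by force
  have eq: "mset (ps @ [x w]) = mset (ys @ map x vs)" using ps ws by simp
  note d = distinct_zigzag[OF eq assms(1,2) vs(1) less]
  show ?thesis
  proof (rule has_cycleI[of "ps @ [x w]"])
    show "length (ps @ [x w]) = 2 * k"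
      using d(3) list_all2_lengthD[OF vs(2)] assms by simp
    show "set (ps @ [x w]) \<subseteq> range x \<union> Y" using d(2) assms by auto
    show "distinct (ps @ [x w])" using d(1) .
    show "successively (\<lambda>u v. \<not> r u v) (ps @ [x w])" "\<not> r (last (ps @ [x w])) (hd (ps @ [x w]))"
      using ps ws(3) sym by (auto simp: successively_append_iff W_def)
  qed
qed

text \<open>Two blue edges at \<open>b\<close> inside \<open>Y\<close> replace one passage through
  \<open>x\<close>, so that \<open>k + 1\<close> vertices of \<open>Y\<close> need only
  \<open>k - 1\<close> representatives.\<close>

lemma blue_cycle_hub:
  assumes "distinct (b # ys)" "set (b # ys) \<subseteq> Y" "length ys = k" "1 \<le> k"
    "\<not> r b (hd ys)" "\<not> r (last ys) b" "sdr (links W ys)"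
  shows "blue_cycle k"
proof -
  obtain ws where ws: "distinct ws" "list_all2 (\<in>) ws (links W ys)"
    using assms(7) by (auto simp: sdr_def)
  then have less: "set ws \<subseteq> {..<2 * l}"
    by (intro sdr_less) (auto dest: links_W_less)
  obtain ps where ps: "mset ps = mset (ys @ map x ws)" "ps \<noteq> []"
    "successively (\<lambda>u v. \<not> r u v) ps" "hd ps = hd ys" "last ps = last ys"
    using blue_zigzag[OF ws(2)] assms by force
  have eq: "mset (b # ps) = mset ((b # ys) @ map x ws)" using ps ws by simp
  note d = distinct_zigzag[OF eq assms(1,2) ws(1) less]
  show ?thesis
  proof (rule has_cycleI[of "b # ps"])
    show "length (b # ps) = 2 * k"
      using d(3) list_all2_lengthD[OF ws(2)] assms by simp
    show "set (b # ps) \<subseteq> range x \<union> Y" using d(2) assms(2) by auto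
    show "distinct (b # ps)" using d(1) .
    show "successively (\<lambda>u v. \<not> r u v) (b # ps)" "\<not> r (last (b # ps)) (hd (b # ps))"
      using ps assms by (auto simp: successively_Cons)
  qed
qed

text \<open>Here the two blue edges inside \<open>Y\<close> attach \<open>b\<close> and
  \<open>c\<close> to the ends of the zigzag on \<open>ys\<close>, while \<open>b\<close> and
  \<open>c\<close> are joined through \<open>x\<close>; again \<open>k - 1\<close> representatives
  serve \<open>k + 1\<close> vertices.\<close>

lemma blue_cycle_two_edges:
  assumes "distinct (b # c # ys)" "set (b # c # ys) \<subseteq> Y" "Suc (length ys) = k" "2 \<le> k"
    "\<not> r c (hd ys)" "\<not> r (last ys) b" "sdr (W b c # links W ys)"
  shows "blue_cycle k"
proof -
  obtain vs where vs: "distinct vs" "list_all2 (\<in>) vs (W b c # links W ys)"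
    using assms(7) by (auto simp: sdr_def)
  have less: "set vs \<subseteq> {..<2 * l}"
    by (rule sdr_less[OF vs(2)]) (metis W_less links_W_less set_ConsD)
  obtain w ws where ws: "vs = w # ws" "list_all2 (\<in>) ws (links W ys)" "w \<in> W b c"
    using vs by (auto simp: list_all2_Cons2)
  obtain ps where ps: "mset ps = mset (ys @ map x ws)" "ps \<noteq> []"
    "successively (\<lambda>u v. \<not> r u v) ps" "hd ps = hd ys" "last ps = last ys"
    using blue_zigzag[OF ws(2)] assms by force
  have eq: "mset (b # x w # c # ps) = mset ((b # c # ys) @ map x vs)" using ps ws by simp
  note d = distinct_zigzag[OF eq assms(1,2) vs(1) less]
  show ?thesis
  proof (rule has_cycleI[of "b # x w # c # ps"])
    show "length (b # x w # c # ps) = 2 * k"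
      using d(3) list_all2_lengthD[OF vs(2)] assms by simp
    show "set (b # x w # c # ps) \<subseteq> range x \<union> Y" using d(2) assms(2) by auto
    show "distinct (b # x w # c # ps)" using d(1) .
    show "successively (\<lambda>u v. \<not> r u v) (b # x w # c # ps)"
      "\<not> r (last (b # x w # c # ps)) (hd (b # x w # c # ps))"
      using ps ws(3) assms sym by (auto simp: successively_Cons W_def)
  qed
qed

lemma links_card:
  assumes "A \<in> set (links W ys)" "distinct ys" "set ys \<subseteq> G"
    "\<And>y z. y \<in> G \<Longrightarrow> z \<in> G \<Longrightarrow> y \<noteq> z \<Longrightarrow> m \<le> card (W y z)"
  shows "m \<le> card A"
  using assms by (metis set_links_distinct subsetD)

section \<open>Finding a blue cycle beside the red one\<close>

text \<open>A closed zigzag through \<open>G\<close> may begin with \<open>a\<close>,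
  \<open>b\<close>, \<open>c\<close>. If it fails, \<open>no_sdr\<close> makes its \<open>k\<close>
  sets equal and of size \<open>k - 1\<close>; beginning with \<open>b\<close>, \<open>a\<close>,
  \<open>c\<close> instead brings in \<open>W a c\<close>.\<close>

lemma no_closed_triple:
  assumes "G \<subseteq> Y" "finite G" "card G = k" "\<not> blue_cycle k"
    "\<And>y z. y \<in> G \<Longrightarrow> z \<in> G \<Longrightarrow> y \<noteq> z \<Longrightarrow> k \<le> Suc (card (W y z))"
    "distinct [a, b, c]" "{a, b, c} \<subseteq> G"
  shows "W a b = W b c \<and> W a b = W a c \<and> Suc (card (W a b)) = k"
proof -
  have *: "W a b = W b c \<and> Suc (card (W a b)) = k"
    if "distinct [a, b, c]" "{a, b, c} \<subseteq> G" for a b c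
  proof -
    obtain zs where zs: "distinct zs" "set zs = G - {a, b, c}"
      using obtain_list_minus[OF assms(2)] by blast
    let ?ys = "a # b # c # zs"
    have ys: "distinct ?ys" "set ?ys = G" using zs that by auto
    then have len: "length ?ys = k" using assms(3) distinct_card by metis
    let ?As = "links W ?ys @ [W (last ?ys) (hd ?ys)]"
    have nosdr: "\<not> sdr ?As"
    proof
      assume "sdr ?As"
      then have "blue_cycle k"
        using ys len assms(1) by (intro blue_cycle_closed[of ?ys]) auto
      then show False using assms(4) by blast
    qed
    have lenA: "length ?As = k" using len by simp
    have "length ?As \<le> Suc (card A)" if "A \<in> set ?As" for A
    proof (cases "A \<in> set (links W ?ys)")
      case True
      then obtain y z where "y \<in> set ?ys" "z \<in> set ?ys" "y \<noteq> z" "A = W y z"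
        using ys(1) by (rule set_links_distinct)
      then show ?thesis using assms(5)[of y z] unfolding lenA ys(2) by blast
    next
      case False
      then have A: "A = W (last ?ys) (hd ?ys)" using that by auto
      have "last ?ys \<in> set (b # c # zs)" using last_in_set[of "b # c # zs"] by simp
      then have "last ?ys \<in> G" "last ?ys \<noteq> a" using ys by auto
      then show ?thesis
        using A assms(5)[of "last ?ys" a] \<open>{a, b, c} \<subseteq> G\<close> unfolding lenA by simp
    qed
    note eq = no_sdr[OF nosdr this, of "W a b" "W b c"]
    have "W a b \<in> set ?As" "W b c \<in> set ?As" by simp_all
    then show ?thesis using eq lenA by simp
  qed
  from *[of a b c] *[of b a c] assms show ?thesis by (auto simp: W_commute)
qed

text \<open>With \<open>b\<close> as hub there are \<open>k - 1\<close> sets, each of at least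
  \<open>l - 1\<close>, hence at least \<open>k - 2\<close>, elements by \<open>card_W\<close>. This
  is the borderline of \<open>no_sdr\<close>.\<close>

lemma no_hub_path:
  assumes "good e G" "finite G" "card G = k" "\<not> blue_cycle k" "k \<le> Suc l"
    "b \<in> Y" "b \<notin> G" "distinct ys" "set ys = G" "\<not> r b (hd ys)" "\<not> r b (last ys)"
    "A \<in> set (links W ys)" "B \<in> set (links W ys)"
  shows "A = B" "card A = k - 2"
proof -
  have len: "length ys = k" using assms distinct_card by metis
  have ne: "1 \<le> k" using assms(12) len by (cases ys) auto
  have nosdr: "\<not> sdr (links W ys)"
  proof
    assume "sdr (links W ys)"
    then have "blue_cycle k"
      using assms len ne sym by (intro blue_cycle_hub[of b ys]) (auto simp: good_def)
    then show False using assms(4) by blast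
  qed
  have size: "l - 1 \<le> card A" if "A \<in> set (links W ys)" for A
  proof (rule links_card[OF that])
    show "l - 1 \<le> card (W y z)" if "y \<in> G" "z \<in> G" "y \<noteq> z" for y z
      using card_W[OF assms(1) that] by linarith
  qed (use assms in auto)
  have *: "length (links W ys) \<le> Suc (card A)" if "A \<in> set (links W ys)" for A
    using size[OF that] assms(5) len by simp
  show "A = B" "card A = k - 2"
    using no_sdr[OF nosdr *, of A B] assms(12,13) len by auto
qed

text \<open>As \<open>4 <= k\<close>, the path from \<open>p\<close> to \<open>q\<close> passes two
  further vertices \<open>c\<close>, \<open>d\<close>, whose order may be exchanged. So
  \<open>p\<close>, \<open>c\<close>, \<open>d\<close> share one common neighbourhood, of size
  \<open>k - 2 < l\<close>, against \<open>card_W_triple\<close>.\<close>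

lemma no_hub_two:
  assumes "good e G" "finite G" "card G = k" "\<not> blue_cycle k" "k \<le> Suc l" "4 \<le> k"
    "b \<in> Y" "b \<notin> G" "p \<in> G" "q \<in> G" "p \<noteq> q" "\<not> r b p" "\<not> r b q"
  shows False
proof -
  have "card (G - {p, q}) \<ge> 2"
    using assms by (simp add: card_Diff_subset)
  then obtain c d where cd: "c \<in> G - {p, q}" "d \<in> G - {p, q}" "c \<noteq> d"
    by (metis card_le_Suc0_iff_eq assms(2) finite_Diff not_less_eq_eq numeral_2_eq_2)
  obtain zs where zs: "distinct zs" "set zs = G - {p, q, c, d}"
    using obtain_list_minus[OF assms(2)] by blast
  have *: "W p u = W u v \<and> card (W p u) = k - 2" if "u = c \<and> v = d \<or> u = d \<and> v = c" for u v
  proof -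
    let ?ys = "p # u # v # zs @ [q]"
    have "set ?ys = G" "distinct ?ys"
      using zs cd assms(9-11) that by auto
    note path = no_hub_path[OF assms(1-5,7,8) this(2,1)]
    have "W p u \<in> set (links W ?ys)" "W u v \<in> set (links W ?ys)" by simp_all
    then show ?thesis using path[of "W p u" "W u v"] assms(12,13) by simp
  qed
  from *[of c d] *[of d c]
  have "W p c = W c d" "W p d = W d c" "card (W p c) = k - 2" by auto
  then have "l \<le> card (W p c)"
    using card_W_triple[of e G p c d] assms cd by (auto simp: W_commute)
  then show False using \<open>card (W p c) = k - 2\<close> assms by auto
qed

text \<open>For \<open>k = 3\<close>, exchanging \<open>c\<close> and \<open>d\<close> changes the
  end of the path. This is harmless if \<open>b\<close> is blue to all of \<open>G\<close>, and the
  argument of \<open>no_hub_two\<close> goes through.\<close>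

lemma no_hub_all:
  assumes "good e G" "finite G" "card G = k" "\<not> blue_cycle k" "k \<le> Suc l" "3 \<le> k"
    "b \<in> Y" "b \<notin> G" "\<And>p. p \<in> G \<Longrightarrow> \<not> r b p"
  shows False
proof -
  obtain S where "S \<subseteq> G" "card S = 3"
    using obtain_subset_with_card_n[of 3 G] assms by metis
  then obtain p c d where pcd: "{p, c, d} \<subseteq> G" "p \<noteq> c" "p \<noteq> d" "c \<noteq> d"
    by (auto simp: card_3_iff)
  obtain zs where zs: "distinct zs" "set zs = G - {p, c, d}"
    using obtain_list_minus[OF assms(2)] by blast
  have *: "W p u = W u v \<and> card (W p u) = k - 2" if "u = c \<and> v = d \<or> u = d \<and> v = c" for u v
  proof -
    let ?ys = "p # u # v # zs"
    have ys: "set ?ys = G" "distinct ?ys"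
      using zs pcd that by auto
    note path = no_hub_path[OF assms(1-5,7,8) ys(2,1)]
    have "last ?ys \<in> G" "hd ?ys \<in> G"
      using last_in_set[of ?ys] ys(1) pcd by auto
    moreover have "W p u \<in> set (links W ?ys)" "W u v \<in> set (links W ?ys)" by simp_all
    ultimately show ?thesis using path[of "W p u" "W u v"] assms(9) by blast
  qed
  from *[of c d] *[of d c]
  have "W p c = W c d" "W p d = W d c" "card (W p c) = k - 2" by auto
  then have "l \<le> card (W p c)"
    using card_W_triple[of e G p c d] assms pcd by (auto simp: W_commute)
  then show False using \<open>card (W p c) = k - 2\<close> assms by auto
qed

text \<open>A closed zigzag can fail only if three vertices share one common neighbourhood of size
  \<open>k - 1 < l\<close>, against \<open>card_W_triple\<close>.\<close>

lemma blue_cycle_if_short: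
  assumes "good e G" "finite G" "card G = k" "3 \<le> k" "k \<le> l"
  shows "blue_cycle k"
proof (rule ccontr)
  assume nb: "\<not> blue_cycle k"
  obtain a b c where abc: "{a, b, c} \<subseteq> G" "distinct [a, b, c]"
    using obtain_three assms(3,4) by metis
  have "k \<le> Suc (card (W y z))" if "y \<in> G" "z \<in> G" "y \<noteq> z" for y z
    using card_W[OF assms(1) that] assms(5) by simp
  from no_closed_triple[OF _ assms(2,3) nb this abc(2,1)] assms(1)
  have "W a b = W b c" "W a b = W a c" "Suc (card (W a b)) = k" by (auto simp: good_def)
  then show False using card_W_triple[OF assms(1) abc(1)] assms(5) by simp
qed

lemma card_W_less_2:
  assumes "good e G" "y \<in> G" "z \<in> G" "y \<noteq> z" "\<not> blue_cycle 2"
  shows "card (W y z) < 2"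
proof (rule ccontr)
  assume *: "\<not> ?thesis"
  have "sdr [W y z, W z y]"
    by (rule sdr_if_one_large[of _ "W y z"]) (use * in \<open>auto simp: W_commute\<close>)
  then have "blue_cycle 2"
    using assms by (intro blue_cycle_closed[of "[y, z]"]) (auto simp: good_def)
  then show False using assms(5) by blast
qed

text \<open>On a four-cycle every vertex is next to \<open>x i\<close> or \<open>x (Suc i)\<close>,
  both red to \<open>u\<close>. So a red edge \<open>u y\<close> and the neighbour
  \<open>x j\<close> of \<open>y\<close> would give a transit.\<close>

lemma blue_if_insertable:
  assumes "l = 2" "u \<in> Y" "y \<in> Y" "u \<noteq> y" "r u (x i)" "r u (x (Suc i))" "r y (x j)"
  shows "\<not> r u y"
proof
  assume uy: "r u y"
  have "j mod 4 = i mod 4 \<or> j mod 4 = Suc i mod 4 \<or> j mod 4 = Suc (Suc i) mod 4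
      \<or> Suc j mod 4 = i mod 4"
  proof -
    have "b = a \<or> b = Suc a mod 4 \<or> b = Suc (Suc a) mod 4 \<or> Suc b mod 4 = a"
      if "a < 4" "b < 4" for a b :: nat
    proof -
      have "a = 0 \<or> a = 1 \<or> a = 2 \<or> a = 3" "b = 0 \<or> b = 1 \<or> b = 2 \<or> b = 3"
        using that by linarith+
      then show ?thesis by (elim disjE) simp_all
    qed
    from this[of "i mod 4" "j mod 4"] show ?thesis by (simp add: mod_Suc_eq mod_Suc_Suc_eq)
  qed
  then have "x j = x i \<or> x j = x (Suc i) \<or> x j = x (Suc (Suc i)) \<or> x (Suc j) = x i"
    using assms(1) by (simp add: x_eq)
  moreover have "r y u" using uy by (rule sym)
  ultimately show False
    using no_transit[of u y i] no_transit[of u y "Suc i"] no_transit[of y u i]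
      no_transit[of y u j] assms uy by auto
qed

text \<open>Two common blue neighbours on \<open>x\<close> close a blue four-cycle at once; so does
  one, if the two vertices are both blue to the third vertex of \<open>Y\<close>.\<close>

lemma blue_4_cycle:
  assumes "card Y = 3"
  shows "blue_cycle 2"
proof (rule ccontr)
  assume nb: "\<not> blue_cycle 2"
  have hub: False if "distinct [a, b, c]" "{a, b, c} \<subseteq> Y" "\<not> r b a" "\<not> r b c" "card (W a c) \<noteq> 0"
    for a b c
  proof -
    have "sdr (links W [a, c])"
      using that(5) by (auto intro!: sdr_greedy)
    then have "blue_cycle 2"
      using that sym by (intro blue_cycle_hub[of b "[a, c]"]) auto
    then show False using nb by blast
  qed
  obtain a b c where Y: "{a, b, c} \<subseteq> Y" "distinct [a, b, c]"
    using obtain_three[of Y] assms by auto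
  then have Y_eq: "Y = {a, b, c}"
    using card_seteq[OF finite_Y, of "{a, b, c}"] assms by auto
  show False
  proof (rule good_cases)
    fix e assume good: "good e Y"
    have "\<not> r y z \<and> card (W y z) \<noteq> 0" if "y \<in> Y" "z \<in> Y" "y \<noteq> z" for y z
      using card_W[OF good that] card_W_red[OF good that] card_W_less_2[OF good that nb] l2
      by linarith
    then show False using hub[of a b c] Y by auto
  next
    fix u i assume u: "u \<in> Y" "r u (x i)" "r u (x (Suc i))" "good (2 * l) (Y - {u})"
    obtain y z where yz: "Y - {u} = {y, z}" "distinct [y, u, z]"
      using u(1) Y Y_eq by auto
    then have mem: "y \<in> Y - {u}" "z \<in> Y - {u}" "y \<noteq> z" by auto
    have w: "card (W y z) < 2" "l \<le> Suc (card (W y z))"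
      using card_W[OF u(4) mem] card_W_less_2[OF u(4) mem nb] by auto
    \<comment> \<open>With fewer than two common blue neighbours, neither \<open>y\<close> nor
      \<open>z\<close> is blue to the whole red four-cycle, so \<open>blue_if_insertable\<close>
      makes \<open>u\<close> a hub.\<close>
    then have "l = 2" using l2 by simp
    moreover have "\<exists>j. r y (x j)" "\<exists>j. r z (x j)"
    proof -
      have "card (W y z) < l" "card (W z y) < l"
        using w(1) \<open>l = 2\<close> W_commute[of y z] by simp_all
      then show "\<exists>j. r y (x j)" "\<exists>j. r z (x j)"
        using red_neighbour_if_card_W_less[OF u(4)] mem by blast+
    qed
    ultimately have "\<not> r u y" "\<not> r u z"
      using blue_if_insertable u mem by blast+
    moreover have "card (W y z) \<noteq> 0" using w(2) l2 by linarith
    ultimately show False using hub[of y u z] yz(2) mem u(1) by auto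
  qed
qed

text \<open>A vertex joined in red to \<open>u\<close> has no red neighbour among the four vertices around the edge into
  which \<open>u\<close> can be inserted; so either \<open>u\<close> has two blue neighbours and closes a zigzag path, or almost
  all common neighbourhoods are large.\<close>

lemma exceptional_blue_cycle:
  assumes u: "u \<in> Y" "i < 2 * l" "r u (x i)" "r u (x (Suc i))" "good (2 * l) (Y - {u})"
    and "card (Y - {u}) = Suc l"
  shows "blue_cycle (Suc l)"
proof (rule ccontr)
  assume nb: "\<not> blue_cycle (Suc l)"
  let ?G = "Y - {u}"
  have fin: "finite ?G" using finite_Y by simp
  show False
  proof (cases "\<exists>d\<in>?G. \<forall>y\<in>?G - {d}. r u y")
    case True
    then obtain d where d: "d \<in> ?G" "\<And>y. y \<in> ?G - {d} \<Longrightarrow> r u y" by blast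
    \<comment> \<open>The cyclic predecessor of \<open>i\<close>; the four vertices in question are
      at \<open>a\<close>, \<open>i\<close>, \<open>s i\<close>, \<open>s (s i)\<close>.\<close>
    define a where "a = (if i = 0 then 2 * l - 1 else i - 1)"
    have sa: "s a = i" "a < 2 * l" using u(2) l2 by (auto simp: a_def)
    have xa: "x (Suc a) = x i" using x_mod[of "Suc a"] sa by simp
    have none: "\<not> r y (x a)" "\<not> r y (x i)" "\<not> r y (x (Suc i))" "\<not> r y (x (Suc (Suc i)))"
      if y: "y \<in> ?G - {d}" for y
      using no_transit[of y u a] xa no_transit[of y u i] no_transit[of u y i]
        no_transit[of u y "Suc i"] y d(2)[OF y] u sym l2 by auto
    have neq: "a \<noteq> i" "a \<noteq> s i" "i \<noteq> s i" "a \<noteq> s (s i)" "i \<noteq> s (s i)"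
      using u(2) l2 by (auto simp: mod_Suc a_def)
    have big: "Suc l \<le> card (W y z)" if "y \<in> ?G - {d}" "z \<in> ?G - {d}" "y \<noteq> z" for y z
    proof -
      have "a \<in> W y z" "i \<in> W y z" "s i \<in> W y z" "s (s i) \<in> W y z"
        using none[OF that(1)] none[OF that(2)] u(2) sa(2) by (simp_all add: W_def)
      \<comment> \<open>Three consecutive pairs inside \<open>W y z\<close> against at most two gaps
        give \<open>2 * l + 1 <= 2 * card (W y z)\<close>.\<close>
      then have "{a, i, s i} \<subseteq> {i. i < 2 * l \<and> i \<in> W y z \<and> s i \<in> W y z}"
        using u(2) sa by simp
      from card_mono[OF _ this] have "3 \<le> card {i. i < 2 * l \<and> i \<in> W y z \<and> s i \<in> W y z}"
        using neq(1-3) by simp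
      moreover have "card {i. i < 2 * l \<and> i \<notin> W y z \<and> s i \<notin> W y z} \<le> 2"
        using card_gaps[OF u(5), of y z] that by simp
      ultimately show ?thesis using card_shift_W[of y z] by linarith
    qed
    have two: "2 \<le> card (W d y)" if "y \<in> ?G - {d}" for y
    proof -
      \<comment> \<open>As \<open>d\<close> cannot be inserted, it is blue to an end of each of
        these two cycle edges.\<close>
      have "\<not> r d (x a) \<or> \<not> r d (x i)" "\<not> r d (x (s i)) \<or> \<not> r d (x (s (s i)))"
        using u(5) d(1) sa xa u(2) s_less[of i] unfolding good_def
        by (metis less_irrefl x_mod)+
      then obtain p q where "p = a \<or> p = i" "q = s i \<or> q = s (s i)" "\<not> r d (x p)" "\<not> r d (x q)"
        by blast
      moreover from this have "\<not> r y (x p)" "\<not> r y (x q)" using none[OF that] by (auto simp: mod_Suc_eq)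
      moreover have "p < 2 * l" "q < 2 * l" using calculation u(2) sa by auto
      ultimately have "{p, q} \<subseteq> W d y" "p \<noteq> q" using neq by (auto simp: W_def)
      then show ?thesis using card_mono[of "W d y" "{p, q}"] by simp
    qed
    obtain ys where ys: "distinct ys" "set ys = ?G - {d}"
      using obtain_list_minus[OF fin, of "{d}"] by blast
    then have len: "length ys = l" using assms(6) d(1) fin by (metis card_Diff_singleton diff_Suc_1 distinct_card)
    then have ne: "ys \<noteq> []" using l2 by auto
    let ?As = "links W (d # ys) @ [W (last ys) d]"
    have As: "?As = W d (hd ys) # links W ys @ [W (last ys) d]"
      using ne by (cases ys) auto
    have "hd ys \<in> ?G - {d}" "last ys \<in> ?G - {d}"
      using hd_in_set[OF ne] last_in_set[OF ne] unfolding ys(2) by blast+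
    from this[THEN two] have ends: "2 \<le> card (W d (hd ys))" "2 \<le> card (W (last ys) d)"
      using W_commute[of d "last ys"] by simp_all
    \<comment> \<open>The two sets at \<open>d\<close>, for which only size two is known, come
      first; each other set has at least as many elements as there are sets.\<close>
    have "sdr ([W d (hd ys), W (last ys) d] @ links W ys)"
    proof (rule sdr_greedy)
      fix j assume j: "j < length ([W d (hd ys), W (last ys) d] @ links W ys)"
      show "j < card (([W d (hd ys), W (last ys) d] @ links W ys) ! j)"
      proof (cases "j < 2")
        case True
        then have "j = 0 \<or> j = 1" by auto
        then show ?thesis using ends by auto
      next
        case False
        then have "([W d (hd ys), W (last ys) d] @ links W ys) ! j = links W ys ! (j - 2)"
          by (simp add: nth_append numeral_2_eq_2)
        moreover have "links W ys ! (j - 2) \<in> set (links W ys)" using j False by (intro nth_mem) auto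
        then have "Suc l \<le> card (links W ys ! (j - 2))"
          by (rule links_card[OF _ ys(1) equalityD1[OF ys(2)] big])
        ultimately show ?thesis using j len l2 by simp
      qed
    qed
    then have "sdr ?As" unfolding As by (rule sdr_mset_eq[rotated]) simp
    then have "blue_cycle (Suc l)"
      using ys len d(1) ne l2 by (intro blue_cycle_closed[of "d # ys"]) auto
    then show False using nb by blast
  next
    case False
    have "?G \<noteq> {}" using assms(6) by (metis card.empty nat.distinct(1))
    then obtain p where p: "p \<in> ?G" "\<not> r u p" using False by blast
    then obtain q where q: "q \<in> ?G" "p \<noteq> q" "\<not> r u q" using False by blast
    show False
    proof (cases "l = 2")
      case False
      then show False
        using no_hub_two[OF u(5) fin assms(6) nb _ _ u(1) _ p(1) q(1,2) p(2) q(3)] l2 by simp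
    next
      \<comment> \<open>Three vertices are too few for \<open>no_hub_two\<close>. The tight path
        through \<open>v\<close> leaves each vertex of \<open>?G\<close> a red neighbour on the
        four-cycle, so \<open>u\<close> is blue to all of them.\<close>
      case l: True
      have "\<not> ?G \<subseteq> {p, q}"
        using assms(6) l card_mono[of "{p, q}" ?G] q(2) by auto
      then obtain v where v: "v \<in> ?G" "v \<noteq> p" "v \<noteq> q" by blast
      then have G: "{p, v, q} = ?G"
        using p q by (intro card_seteq) (use fin assms(6) l in auto)
      have "distinct [p, v, q]" "set [p, v, q] = ?G" using G v q(2) by auto
      from no_hub_path[OF u(5) fin assms(6) nb _ u(1) _ this, of "W p v" "W v q"] p(2) q(3)
      have "W p v = W v q" "card (W p v) = Suc l - 2" by simp_all
      then have w: "card (W p v) < l" "card (W v p) < l" "card (W q v) < l"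
        using l W_commute[of v p] W_commute[of q v] by simp_all
      have "\<exists>j. r y (x j)" if "y \<in> ?G" for y
      proof -
        note nbr = red_neighbour_if_card_W_less[OF u(5)]
        have "y = p \<or> y = v \<or> y = q" using that unfolding G[symmetric] by simp
        then show ?thesis
          using nbr[OF p(1) v(1) w(1)] nbr[OF v(1) p(1) w(2)] nbr[OF q(1) v(1) w(3)]
          by (elim disjE) simp_all
      qed
      then have "\<not> r u y" if "y \<in> ?G" for y
        using blue_if_insertable[OF l u(1)] u that by blast
      then show False
        using no_hub_all[OF u(5) fin assms(6) nb _ _ u(1)] l by simp
    qed
  qed
qed

text \<open>Excluding hubs, and two blue edges linked by a red one, leaves some
  \<open>Y - {a}\<close> a red clique. Failure of the closed zigzag there yields a red triangle with
  a single common neighbourhood of size \<open>l\<close>. It alternates round the cycle, which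
  permits the detour forbidden by \<open>no_transit2\<close>.\<close>

lemma good_blue_cycle:
  assumes good: "good e Y" and card_Y: "card Y = l + 2"
  shows "blue_cycle (Suc l)"
proof (rule ccontr)
  assume nb: "\<not> blue_cycle (Suc l)"
  have pattern: False
    if "distinct [a, b, c, d]" "{a, b, c, d} \<subseteq> Y" "\<not> r a b" "\<not> r c d" "r b c" for a b c d
  proof -
    obtain zs where zs: "distinct zs" "set zs = Y - {a, b, c, d}"
      using obtain_list_minus[OF finite_Y] by blast
    let ?ys = "d # zs @ [a]"
    have ys: "distinct (b # c # ?ys)" "set (b # c # ?ys) = Y" using zs that by auto
    have len: "length ?ys = l" using distinct_card[OF ys(1)] ys(2) card_Y by simp
    have "sdr (W b c # links W ?ys)"
    proof (rule sdr_if_one_large[of _ "W b c"])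
      have bc: "l \<le> card (W b c)" using card_W_red[OF good, of b c] that by auto
      then show "length (W b c # links W ?ys) \<le> card (W b c)" using len l2 by simp
      fix A assume "A \<in> set (W b c # links W ?ys)"
      then have "A = W b c \<or> A \<in> set (links W ?ys)" by auto
      then have "l - 1 \<le> card A"
      proof
        assume "A \<in> set (links W ?ys)"
        then show ?thesis
        proof (rule links_card)
          show "l - 1 \<le> card (W y z)" if "y \<in> Y" "z \<in> Y" "y \<noteq> z" for y z
            using card_W[OF good that] by linarith
        qed (use ys in auto)
      qed (use bc in simp)
      then show "length (W b c # links W ?ys) \<le> Suc (card A)" using len l2 by simp
    qed simp
    then have "blue_cycle (Suc l)"
      using that ys len l2 by (intro blue_cycle_two_edges[of b c ?ys]) (auto simp: sym_iff)
    then show False using nb by blast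
  qed
  have hub: False if "distinct [a, b, c]" "{a, b, c} \<subseteq> Y" "\<not> r b a" "\<not> r b c" for a b c
  proof -
    let ?G = "Y - {b}"
    have G: "good e ?G" "finite ?G" "card ?G = Suc l" "Suc l \<le> Suc l" "b \<in> Y" "b \<notin> ?G"
      using good_subset[OF good] finite_Y card_Y that by auto
    show False
    proof (cases "l = 2")
      case False
      then show False
        using no_hub_two[OF G(1-3) nb G(4) _ G(5,6), of a c] that l2 by auto
    next
      case l: True
      have "\<not> Y \<subseteq> {a, b, c}"
      proof
        assume "Y \<subseteq> {a, b, c}"
        from card_mono[OF _ this] have "card Y \<le> length [a, b, c]"
          using card_length[of "[a, b, c]"] by simp
        then show False using card_Y l by simp
      qed
      then obtain d where d: "d \<in> Y" "d \<noteq> a" "d \<noteq> b" "d \<noteq> c" by blast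
      have abcd: "distinct [a, d, c]" "set [a, d, c] = ?G"
      proof -
        show "distinct [a, d, c]" using that d by auto
        then show "set [a, d, c] = ?G"
          using that d by (intro card_seteq) (use G(2,3) l in auto)
      qed
      \<comment> \<open>The tight path makes these sets too small for red edges \<open>a d\<close>
        and \<open>d c\<close>. Then \<open>pattern\<close> forces \<open>b d\<close> to be blue
        too, and \<open>b\<close> is blue to all of \<open>?G\<close>.\<close>
      have "card (W a d) = Suc l - 2" "card (W d c) = Suc l - 2"
        using no_hub_path[OF G(1-3) nb G(4-6) abcd, of "W a d" "W d c"]
          no_hub_path[OF G(1-3) nb G(4-6) abcd, of "W d c" "W a d"] that(3,4) by auto
      then have ad: "\<not> r a d" "\<not> r d c"
        using card_W_red[OF good, of a d] card_W_red[OF good, of d c] that d l2 by auto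
      then have "\<not> r b d"
        using pattern[of a b d c] that d sym by auto
      have "\<not> r b y" if "y \<in> ?G" for y
        using that \<open>\<not> r b d\<close> \<open>\<not> r b a\<close> \<open>\<not> r b c\<close> unfolding abcd(2)[symmetric] by auto
      then show False
        using no_hub_all[OF G(1-3) nb G(4) _ G(5,6)] l by simp
    qed
  qed
  obtain a where a: "a \<in> Y" "\<And>u v. u \<in> Y - {a} \<Longrightarrow> v \<in> Y - {a} \<Longrightarrow> u \<noteq> v \<Longrightarrow> r u v"
  proof (cases "\<exists>p\<in>Y. \<exists>q\<in>Y. p \<noteq> q \<and> \<not> r p q")
    case True
    then obtain p q where pq: "p \<in> Y" "q \<in> Y" "p \<noteq> q" "\<not> r p q" by blast
    \<comment> \<open>By \<open>hub\<close>, a blue edge \<open>u v\<close> would avoid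
      \<open>q\<close>, and \<open>q u\<close> would be red; \<open>pattern\<close> excludes
      this.\<close>
    have "r u v" if "u \<in> Y - {p}" "v \<in> Y - {p}" "u \<noteq> v" for u v
    proof (rule ccontr)
      assume uv: "\<not> r u v"
      then have "u \<noteq> q" using hub[of p q v] pq that sym by auto
      moreover from uv have "v \<noteq> q" using hub[of p q u] pq that sym by auto
      moreover from \<open>u \<noteq> q\<close> have "r q u" using hub[of p q u] pq that sym by auto
      ultimately show False using pattern[of p q u v] pq that uv by auto
    qed
    then show ?thesis using that pq(1) by blast
  next
    case False
    moreover obtain p where "p \<in> Y" using card_Y by fastforce
    ultimately show ?thesis using that by blast
  qed
  let ?G = "Y - {a}"
  have G: "?G \<subseteq> Y" "finite ?G" "card ?G = Suc l" "good e ?G"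
    using good_subset[OF good] finite_Y card_Y a(1) by auto
  obtain p q t where pqt: "{p, q, t} \<subseteq> ?G" "distinct [p, q, t]"
    using obtain_three[of ?G] G(3) l2 by auto
  then have pqt_Y: "p \<in> Y" "q \<in> Y" "t \<in> Y" by auto
  have neq: "p \<noteq> q" "q \<noteq> p" "q \<noteq> t" "t \<noteq> q" "p \<noteq> t" "t \<noteq> p"
    using pqt(2) by auto
  have red_pqt: "r p q" "r q p" "r q t" "r t q" "r p t" "r t p"
    using a(2) pqt by auto
  have "Suc l \<le> Suc (card (W y z))" if "y \<in> ?G" "z \<in> ?G" "y \<noteq> z" for y z
    using card_W_red[OF G(4) that a(2)[OF that]] by simp
  from no_closed_triple[OF G(1-3) nb this pqt(2,1)]
  have W: "W p q = W q t" "W p q = W p t" "card (W p q) = l" by auto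
  have cover: "r p (x i) \<or> r q (x i)" "r q (x i) \<or> r t (x i)" "r p (x i) \<or> r t (x i)"
    if "i < 2 * l" "i \<notin> W p q" for i
    using that W(1,2) unfolding W_def by blast+
  \<comment> \<open>At a gap each of the two indices is red to two of the three vertices, so
    different ones can be picked, giving a transit along a red edge.\<close>
  have no_gap: "s i \<in> W p q" if i: "i < 2 * l" "i \<notin> W p q" for i
  proof (rule ccontr)
    assume "s i \<notin> W p q"
    from cover[OF i] cover[OF s_less this]
    show False
      using no_transit[OF pqt_Y(1,2) neq(1) red_pqt(1), of i] no_transit[OF pqt_Y(2,1) neq(2) red_pqt(2), of i]
        no_transit[OF pqt_Y(2,3) neq(3) red_pqt(3), of i] no_transit[OF pqt_Y(3,2) neq(4) red_pqt(4), of i]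
        no_transit[OF pqt_Y(1,3) neq(5) red_pqt(5), of i] no_transit[OF pqt_Y(3,1) neq(6) red_pqt(6), of i]
      unfolding x_mod by blast
  qed
  then have "{i. i < 2 * l \<and> i \<notin> W p q \<and> s i \<notin> W p q} = {}" by blast
  \<comment> \<open>Without gaps and with exactly \<open>l\<close> elements, the count leaves no
    consecutive pair either: membership in \<open>W p q\<close> alternates.\<close>
  then have "card {i. i < 2 * l \<and> i \<in> W p q \<and> s i \<in> W p q} = 0"
    using card_shift_W[of p q] W(3) by (simp only: card.empty)
  then have no_consecutive: "s i \<notin> W p q" if "i \<in> W p q" for i
    using that by (auto simp: W_def)
  have "card ({..<2 * l} - W p q) = l"
    using card_Diff_subset[OF finite_W W_less] W(3) by simp
  then obtain i where i: "i < 2 * l" "i \<notin> W p q"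
    using l2 by (metis DiffE card.empty ex_in_conv lessThan_iff not_numeral_le_zero)
  \<comment> \<open>So \<open>x i\<close> and \<open>x (i + 2)\<close> are each red to two of the
    three vertices; two different ones, with the third between them, form a detour.\<close>
  have "s (s i) \<notin> W p q" using no_consecutive no_gap i by blast
  from cover[OF i] cover[OF s_less this]
  show False
    using no_transit2[OF pqt_Y(1,2,3) neq(5,1,3) red_pqt(1,3), of i]
      no_transit2[OF pqt_Y(3,2,1) neq(6,4,2) red_pqt(4,2), of i]
      no_transit2[OF pqt_Y(1,3,2) neq(1,5,4) red_pqt(5,4), of i]
      no_transit2[OF pqt_Y(2,3,1) neq(2,3,6) red_pqt(3,6), of i]
      no_transit2[OF pqt_Y(2,1,3) neq(3,2,5) red_pqt(2,5), of i]
      no_transit2[OF pqt_Y(3,1,2) neq(4,6,1) red_pqt(6,1), of i]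
    unfolding x_mod x_Suc_mod add_2_eq_Suc' by blast
qed

text \<open>For \<open>3 <= k <= l\<close> one vertex of \<open>Y\<close> is dropped, namely the
  insertable one in the second case of \<open>good_cases\<close>; \<open>k = Suc l\<close> keeps all
  of \<open>Y\<close>.\<close>

theorem blue_cycle:
  assumes "card Y = Suc k" "2 \<le> k" "k \<le> Suc l"
  shows "blue_cycle k"
proof (rule good_cases)
  fix e assume good: "good e Y"
  obtain a where "a \<in> Y" using assms(1) by fastforce
  consider "k = 2" | "3 \<le> k" "k \<le> l" | "k = Suc l" using assms by linarith
  then show ?thesis
  proof cases
    case 2
    then show ?thesis
      using good_subset[OF good, of "Y - {a}"] assms(1) finite_Y \<open>a \<in> Y\<close>
      by (intro blue_cycle_if_short[of e "Y - {a}"]) auto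
  next
    case 3
    then show ?thesis using good_blue_cycle[OF good] assms(1) by simp
  qed (use blue_4_cycle assms(1) in simp)
next
  fix u i assume u: "u \<in> Y" "i < 2 * l" "r u (x i)" "r u (x (Suc i))" "good (2 * l) (Y - {u})"
  consider "k = 2" | "3 \<le> k" "k \<le> l" | "k = Suc l" using assms by linarith
  then show ?thesis
  proof cases
    case 2
    then show ?thesis
      using u assms(1) finite_Y by (intro blue_cycle_if_short[OF u(5)]) auto
  next
    case 3
    then show ?thesis using exceptional_blue_cycle[OF u] assms(1) u(1) finite_Y by simp
  qed (use blue_4_cycle assms(1) in simp)
qed

end

section \<open>Lengthening a red cycle by two\<close>

lemma extend_cycle:
  assumes sym: "\<And>u v. r u v \<Longrightarrow> r v u" and "finite V" "2 * l + k < card V"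
    and "2 \<le> l" "2 \<le> k" "k \<le> Suc l" and cycle: "has_cycle r V (2 * l)"
  shows "has_cycle r V (2 * l + 2) \<or> has_cycle (\<lambda>u v. \<not> r u v) V (2 * k)"
proof (rule ccontr)
  assume *: "\<not> ?thesis"
  obtain xs where xs: "length xs = 2 * l" "set xs \<subseteq> V" "distinct xs" "successively r xs"
      "r (last xs) (hd xs)"
    using cycle by (auto simp: has_cycle_def)
  have "Suc k \<le> card (V - set xs)"
    using assms(2,3) xs by (simp add: card_Diff_subset distinct_card)
  then obtain Y where Y: "Y \<subseteq> V - set xs" "card Y = Suc k"
    using obtain_subset_with_card_n by metis
  define x where "x i = xs ! (i mod (2 * l))" for i
  have l: "0 < 2 * l" using assms(4) by simp
  then have x_in: "x i \<in> set xs" for i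
    using xs(1) mod_less_divisor[OF l, of i] by (auto simp: x_def intro: nth_mem)
  then have subset: "range x \<union> Y \<subseteq> V" using xs(2) Y(1) by auto
  interpret red_cycle r x l Y
  proof
    show "x i = x j \<longleftrightarrow> i mod (2 * l) = j mod (2 * l)" for i j
      using xs(1,3) l by (simp add: x_def nth_eq_iff_index_eq)
    show "r (x i) (x (Suc i))" for i
    proof (cases "Suc (i mod (2 * l)) = 2 * l")
      case True
      then have "i mod (2 * l) = length xs - 1" using xs(1) by simp
      moreover have ne: "xs \<noteq> []" using xs(1) l by auto
      ultimately have "x i = last xs" by (simp add: x_def last_conv_nth)
      moreover have "x (Suc i) = hd xs"
        using True ne by (simp add: x_def mod_Suc hd_conv_nth)
      ultimately show ?thesis using xs(5) by simp
    next
      case False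
      then have "Suc (i mod (2 * l)) < length xs" using l xs(1) by (simp add: Suc_lessI)
      with xs(4) have "r (xs ! (i mod (2 * l))) (xs ! Suc (i mod (2 * l)))"
        by (rule successively_nth)
      then show ?thesis using False by (simp add: x_def mod_Suc)
    qed
    show "x i \<notin> Y" for i using x_in Y(1) by auto
    show "finite Y" using Y(1) assms(2) finite_subset by blast
    show "\<not> has_cycle r (range x \<union> Y) (2 * l + 2)"
      using * has_cycle_mono[OF _ subset] by blast
  qed (use assms in auto)
  show False using blue_cycle[OF Y(2) assms(5,6)] has_cycle_mono[OF _ subset] * by blast
qed

section \<open>Four-cycles on five and six vertices\<close>

lemma has_cycle_4I:
  "distinct [a, b, c, d] \<Longrightarrow> {a, b, c, d} \<subseteq> V \<Longrightarrow> P a b \<Longrightarrow> P b c \<Longrightarrow> P c d \<Longrightarrow> P d a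
   \<Longrightarrow> has_cycle P V 4"
  by (rule has_cycleI[of "[a, b, c, d]"]) auto

text \<open>Some red neighbour \<open>a\<close> of \<open>v\<close> is blue to two others
  \<open>b\<close>, \<open>c\<close>. Each of the two remaining vertices is red to at most one of
  \<open>a\<close>, \<open>b\<close>, \<open>c\<close>, as \<open>v\<close> would close a red
  four-cycle, and to \<open>b\<close> or \<open>c\<close>, as \<open>a\<close> would close a blue
  one. Picking the same vertex gives a blue four-cycle, picking different ones a red one.\<close>

lemma four_cycle_if_degree_3:
  assumes sym: "\<And>u v. r u v \<Longrightarrow> r v u" and "card V = 6" "v \<in> V"
    and "3 \<le> card {u \<in> V - {v}. r v u}"
  shows "has_cycle r V 4 \<or> has_cycle (\<lambda>u v. \<not> r u v) V 4"
proof (rule ccontr)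
  assume "\<not> ?thesis"
  then have red: "\<not> (r p q \<and> r q s \<and> r s t \<and> r t p)"
    and blue: "\<not> (\<not> r p q \<and> \<not> r q s \<and> \<not> r s t \<and> \<not> r t p)"
    if "distinct [p, q, s, t]" "{p, q, s, t} \<subseteq> V" for p q s t
    using has_cycle_4I[OF that, of r] has_cycle_4I[OF that, of "\<lambda>u v. \<not> r u v"] by blast+
  have symI: "r p q \<longleftrightarrow> r q p" for p q using sym by blast
  obtain a' b' c' where abc': "{a', b', c'} \<subseteq> {u \<in> V - {v}. r v u}" "distinct [a', b', c']"
    using obtain_three[OF assms(4)] by blast
  have "\<not> (r a' b' \<and> r b' c')" "\<not> (r b' c' \<and> r c' a')" "\<not> (r c' a' \<and> r a' b')"
    using red[of v a' b' c'] red[of v b' c' a'] red[of v c' a' b'] abc' assms(3) symI by auto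
  then obtain a b c where abc: "{a, b, c} \<subseteq> {u \<in> V - {v}. r v u}" "distinct [a, b, c]"
      "\<not> r a b" "\<not> r a c"
    using abc' symI that[of a' b' c'] that[of b' c' a'] that[of c' a' b'] by auto
  have "finite V" using assms(2) card.infinite by fastforce
  moreover have "{v, a, b, c} \<subseteq> V" "card {v, a, b, c} = 4" using abc assms(3) by auto
  ultimately have "card (V - {v, a, b, c}) = 2"
    using assms(2) card_Diff_subset[of "{v, a, b, c}" V] by simp
  then obtain d e where de: "V - {v, a, b, c} = {d, e}" "d \<noteq> e"
    by (auto simp: card_2_iff)
  then have mem: "{v, a, b, c, d, e} \<subseteq> V" "distinct [v, a, b, c, d, e]"
    using abc assms(3) by auto
  have v: "r v a" "r v b" "r v c" using abc by auto
  have *: "\<not> (r d a \<and> r d b)" "\<not> (r d a \<and> r d c)" "\<not> (r d b \<and> r d c)"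
    "\<not> (r e a \<and> r e b)" "\<not> (r e a \<and> r e c)" "\<not> (r e b \<and> r e c)"
    using red[of v a d b] red[of v a d c] red[of v b d c]
      red[of v a e b] red[of v a e c] red[of v b e c] mem v symI by auto
  have "\<not> (\<not> r d b \<and> \<not> r d c)" "\<not> (\<not> r e b \<and> \<not> r e c)"
    using blue[of a b d c] blue[of a b e c] mem abc symI by auto
  moreover have "\<not> (\<not> r d a \<and> \<not> r d b \<and> \<not> r e a \<and> \<not> r e b)"
    "\<not> (\<not> r d a \<and> \<not> r d c \<and> \<not> r e a \<and> \<not> r e c)"
    using blue[of a d b e] blue[of a d c e] mem symI by auto
  \<comment> \<open>Here \<open>d'\<close> picks \<open>c\<close> and \<open>e'\<close> picks
    \<open>b\<close>; blue four-cycles through \<open>a\<close> are avoided only if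
    \<open>b c\<close> and \<open>d' e'\<close> are red.\<close>
  moreover have False if "\<not> r d' a" "\<not> r d' b" "r d' c" "\<not> r e' a" "\<not> r e' c" "r e' b"
    "d' = d \<and> e' = e \<or> d' = e \<and> e' = d" for d' e'
  proof -
    have mem': "distinct [v, a, b, c, d', e']" "{v, a, b, c, d', e'} \<subseteq> V" using mem that(7) by auto
    then have "r b c" "r d' e'"
      using blue[of a d' b c] blue[of d' e' c a] abc that symI by auto
    then show False
      using red[of d' c b e'] mem' that symI by auto
  qed
  ultimately show False using * by blast
qed

lemma four_cycle:
  assumes sym: "\<And>u v. r u v \<Longrightarrow> r v u" and "6 \<le> card V"
  shows "has_cycle r V 4 \<or> has_cycle (\<lambda>u v. \<not> r u v) V 4"
proof -
  obtain S where S: "S \<subseteq> V" "card S = 6"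
    using obtain_subset_with_card_n[OF assms(2)] by metis
  then have fin: "finite S" by (metis card.infinite zero_neq_numeral)
  obtain v where v: "v \<in> S" using S(2) by fastforce
  let ?A = "{u \<in> S - {v}. r v u}" and ?B = "{u \<in> S - {v}. \<not> r v u}"
  have "card ?A + card ?B = card (?A \<union> ?B)"
    using fin by (intro card_Un_disjoint[symmetric]) auto
  also have "?A \<union> ?B = S - {v}" by auto
  also have "card (S - {v}) = 5" using S(2) v fin by simp
  finally consider "3 \<le> card ?A" | "3 \<le> card ?B" by linarith
  then have "has_cycle r S 4 \<or> has_cycle (\<lambda>u v. \<not> r u v) S 4"
  proof cases
    case 1
    with sym S(2) v show ?thesis by (rule four_cycle_if_degree_3)
  next
    case 2
    have "has_cycle (\<lambda>u v. \<not> r u v) S 4 \<or> has_cycle (\<lambda>u v. \<not> \<not> r u v) S 4"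
      by (rule four_cycle_if_degree_3[of "\<lambda>u v. \<not> r u v", OF _ S(2) v 2]) (use sym in blast)
    then show ?thesis by auto
  qed
  then show ?thesis using has_cycle_mono[OF _ S(1)] by blast
qed

text \<open>The larger side spans only blue edges, so it has three vertices, and each vertex of the
  other side is red to at least two of them. If the two vertices there are blue to different ones,
  these four form a blue cycle; otherwise they have two red neighbours in common.\<close>

lemma four_cycle_bipartite:
  assumes sym: "\<And>u v. r u v \<Longrightarrow> r v u" and "A \<inter> B = {}" "card (A \<union> B) = 5"
    and A: "\<And>u v. u \<in> A \<Longrightarrow> v \<in> A \<Longrightarrow> u \<noteq> v \<Longrightarrow> \<not> r u v" and B: "\<And>u v. u \<in> B \<Longrightarrow> v \<in> B \<Longrightarrow> u \<noteq> v \<Longrightarrow> \<not> r u v"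
  shows "has_cycle r (A \<union> B) 4 \<or> has_cycle (\<lambda>u v. \<not> r u v) (A \<union> B) 4"
proof -
  have *: "has_cycle r (A \<union> B) 4 \<or> has_cycle (\<lambda>u v. \<not> r u v) (A \<union> B) 4"
    if AB: "A \<inter> B = {}" "card (A \<union> B) = 5" "3 \<le> card A"
    and A: "\<And>u v. u \<in> A \<Longrightarrow> v \<in> A \<Longrightarrow> u \<noteq> v \<Longrightarrow> \<not> r u v" and B: "\<And>u v. u \<in> B \<Longrightarrow> v \<in> B \<Longrightarrow> u \<noteq> v \<Longrightarrow> \<not> r u v"
    for A B
  proof (rule ccontr)
    assume "\<not> ?thesis"
    then have nr: "\<not> has_cycle r (A \<union> B) 4" and nb: "\<not> has_cycle (\<lambda>u v. \<not> r u v) (A \<union> B) 4"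
      by simp_all
    have red: "\<not> (r p q \<and> r q s \<and> r s t \<and> r t p)"
      if "distinct [p, q, s, t]" "{p, q, s, t} \<subseteq> A \<union> B" for p q s t
      using has_cycle_4I[OF that, of r] nr by auto
    have blue: "\<not> (\<not> r p q \<and> \<not> r q s \<and> \<not> r s t \<and> \<not> r t p)"
      if "distinct [p, q, s, t]" "{p, q, s, t} \<subseteq> A \<union> B" for p q s t
      using has_cycle_4I[OF that, of "\<lambda>u v. \<not> r u v"] nb by auto
    have symI: "r p q \<longleftrightarrow> r q p" for p q using sym by blast
    obtain a b c where abc: "{a, b, c} \<subseteq> A" "distinct [a, b, c]"
      using obtain_three[OF AB(3)] by blast
    have no_fourth: "d \<in> {a, b, c}" if "d \<in> A" for d
      using blue[of a b c d] abc that A by auto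
    have fin: "finite (A \<union> B)" by (rule card_ge_0_finite) (simp add: AB(2))
    have "A = {a, b, c}" using no_fourth abc(1) by blast
    then have "card B = 2"
      using AB(1,2) abc(2) fin card_Un_disjoint[of A B] by simp
    then obtain d e where de: "B = {d, e}" "d \<noteq> e" by (auto simp: card_2_iff)
    have side: "d \<in> B" "e \<in> B" "a \<in> A" "b \<in> A" "c \<in> A" using de abc by auto
    have "r w p \<or> r w q" if "w \<in> B" "p \<in> A" "q \<in> A" "s \<in> A" "distinct [p, q, s]" for w p q s
    proof -
      have "w \<notin> A" using AB(1) that(1) by auto
      then show ?thesis
        using blue[of p w q s] that A[of q s] A[of s p] symI[of p w] by auto
    qed
    from this[of _ a b c] this[of _ b c a] this[of _ a c b]
    have "r w a \<or> r w b" "r w b \<or> r w c" "r w a \<or> r w c" if "w \<in> B" for w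
      using that abc(2) side by auto
    from this[OF side(1)] this[OF side(2)]
    have two: "r d a \<or> r d b" "r d b \<or> r d c" "r d a \<or> r d c"
      "r e a \<or> r e b" "r e b \<or> r e c" "r e a \<or> r e c" by auto
    have "\<not> (r d p \<and> r d q \<and> r e p \<and> r e q) \<and> \<not> (\<not> r d p \<and> \<not> r e q)"
      if "distinct [p, q]" "p \<in> A" "q \<in> A" for p q
    proof -
      have "d \<notin> A" "e \<notin> A" using AB(1) side by auto
      then show ?thesis
        using red[of d p e q] blue[of d p q e] that side de(2) A[of p q] B[of e d]
          symI[of p e] symI[of q d] symI[of q e] by auto
    qed
    from this[of a b] this[of b a] this[of b c] this[of c b] this[of a c] this[of c a]
    show False using two abc(2) side by auto
  qed
  have "finite (A \<union> B)" by (rule card_ge_0_finite) (simp add: assms(3))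
  then have "card A + card B = 5"
    using assms(2,3) card_Un_disjoint[of A B] by simp
  then consider "3 \<le> card A" | "3 \<le> card B" by linarith
  then show ?thesis
  proof cases
    case 1
    with assms(2,3) show ?thesis using A B by (rule *)
  next
    case 2
    have "has_cycle r (B \<union> A) 4 \<or> has_cycle (\<lambda>u v. \<not> r u v) (B \<union> A) 4"
      by (rule *) (use assms(2,3) 2 A B in \<open>auto simp: Un_commute\<close>)
    then show ?thesis by (simp add: Un_commute)
  qed
qed

section \<open>The upper bound by induction\<close>

text \<open>Induction yields a red cycle two shorter, which \<open>extend_cycle\<close> lengthens.
  The extra vertex at \<open>a = 2\<close> is forced by the bull below.\<close>

lemma even_cycles_arrow:
  assumes "\<And>u v. r u v \<Longrightarrow> r v u" "finite V" "2 \<le> k" "k \<le> a"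
    "2 * a + k - 1 + (if a = 2 then 1 else 0) \<le> card V"
  shows "has_cycle r V (2 * a) \<or> has_cycle (\<lambda>u v. \<not> r u v) V (2 * k)"
  using assms
proof (induction "a + k" arbitrary: r a k rule: less_induct)
  case less
  show ?case
  proof (cases "a = 2")
    case True
    then have "k = 2" "6 \<le> card V" using less.prems by auto
    then show ?thesis using four_cycle[of r V] less.prems(1) True by simp
  next
    case False
    then obtain l where l: "a = Suc l" "2 \<le> l" using less.prems(3,4) by (cases a) auto
    have "has_cycle r V (2 * l) \<or> has_cycle r V (2 * a) \<or> has_cycle (\<lambda>u v. \<not> r u v) V (2 * k)"
    proof (cases "k = a")
      case True
      \<comment> \<open>Lowering \<open>a\<close> would violate \<open>k <= a\<close>, so the
        colours are exchanged: blue length \<open>2 * a\<close> against red length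
        \<open>2 * l\<close>.\<close>
      have "has_cycle (\<lambda>u v. \<not> r u v) V (2 * a) \<or> has_cycle (\<lambda>u v. \<not> \<not> r u v) V (2 * l)"
      proof (rule less.hyps)
        show "\<And>u v. \<not> r u v \<Longrightarrow> \<not> r v u" using less.prems(1) by blast
      qed (use less.prems True l in auto)
      then show ?thesis using True by auto
    next
      case False
      have "has_cycle r V (2 * l) \<or> has_cycle (\<lambda>u v. \<not> r u v) V (2 * k)"
        by (rule less.hyps) (use less.prems False l in auto)
      then show ?thesis by auto
    qed
    moreover have "has_cycle r V (2 * a) \<or> has_cycle (\<lambda>u v. \<not> r u v) V (2 * k)"
      if "has_cycle r V (2 * l)"
    proof -
      have "2 * l + k < card V" using less.prems(5) l False by simp
      from extend_cycle[OF less.prems(1,2) this l(2) less.prems(3) _ that] less.prems(4) l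
      show ?thesis by (simp add: add.commute)
    qed
    ultimately show ?thesis by blast
  qed
qed

section \<open>From relations to red-blue graphs\<close>

abbreviation coloured :: "colour \<Rightarrow> nat red_blue_graph \<Rightarrow> nat \<Rightarrow> nat \<Rightarrow> bool" where
  "coloured c K u v \<equiv> edge_colour K {u, v} = c"

lemma coloured_sym: "coloured c K u v \<Longrightarrow> coloured c K v u"
  by (simp add: insert_commute)

lemma not_coloured: "c \<noteq> d \<Longrightarrow> (\<lambda>u v. \<not> coloured c K u v) = coloured d K"
  by (intro ext) (metis colour.exhaust)

lemma contains_copy_if_has_cycle:
  assumes "3 \<le> k" "has_cycle (coloured c K) (points K) k"
  shows "contains_copy (mono_subgraph c K) (cycle_graph k)"
proof -
  obtain xs where xs: "length xs = k" "set xs \<subseteq> points K" "distinct xs"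
      "successively (coloured c K) xs" "coloured c K (last xs) (hd xs)"
    using assms(2) by (auto simp: has_cycle_def)
  have mem: "xs ! j \<in> points K" if "j < k" for j
    using that xs(1,2) nth_mem by blast
  have "(!) xs ` {i, Suc i mod k} \<in> edges (mono_subgraph c K)" if i: "i < k" for i
  proof -
    have "coloured c K (xs ! i) (xs ! (Suc i mod k))"
    proof (cases "Suc i = k")
      case True
      have "xs \<noteq> []" "i = length xs - 1" using True xs(1) i by auto
      then have "coloured c K (xs ! i) (xs ! 0)" using xs(5) by (simp add: last_conv_nth hd_conv_nth)
      then show ?thesis using True by simp
    next
      case False
      then have "Suc i < length xs" using i xs(1) by simp
      with xs(4) show ?thesis using xs(1) by (auto dest: successively_nth)
    qed
    moreover have "i \<noteq> Suc i mod k" "Suc i mod k < k" using i assms(1) by (auto simp: mod_Suc)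
    then have "xs ! i \<noteq> xs ! (Suc i mod k)" "{xs ! i, xs ! (Suc i mod k)} \<subseteq> points K"
      using xs(1,3) i mem[OF i] mem[of "Suc i mod k"] by (simp_all add: nth_eq_iff_index_eq)
    ultimately show ?thesis by (auto simp: mono_subgraph_def nsets_def)
  qed
  moreover have "inj_on ((!) xs) {..<k}" "(!) xs ` {..<k} \<subseteq> points K"
    using xs(1,3) mem by (auto intro: inj_on_nth)
  ultimately show ?thesis
    unfolding contains_copy_def
    by (intro exI[of _ "(!) xs"]) (auto simp: cycle_graph_def mono_subgraph_def)
qed

lemma contains_copy_cycleE:
  assumes "contains_copy (mono_subgraph c K) (cycle_graph k)"
  obtains f where "inj_on f {..<k}" "f ` {..<k} \<subseteq> points K"
    "\<And>i. i < k \<Longrightarrow> coloured c K (f i) (f (Suc i mod k))"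
proof -
  obtain f where f: "inj_on f {..<k}" "f ` {..<k} \<subseteq> points K"
      "\<And>e. e \<in> edges (cycle_graph k) \<Longrightarrow> f ` e \<in> edges (mono_subgraph c K)"
    using assms by (auto simp: contains_copy_def cycle_graph_def mono_subgraph_def)
  show ?thesis
  proof (rule that[OF f(1,2)])
    fix i assume "i < k"
    then have "{i, Suc i mod k} \<in> edges (cycle_graph k)" by (auto simp: cycle_graph_def)
    from f(3)[OF this] show "coloured c K (f i) (f (Suc i mod k))"
      by (simp add: mono_subgraph_def)
  qed
qed

section \<open>Extremal colourings\<close>

text \<open>Used with \<open>p = 2 * max a b - 1\<close> and with \<open>c\<close> the colour in
  which the longer cycle is sought, red if \<open>a = b\<close>.\<close>

definition split_graph :: "colour \<Rightarrow> nat \<Rightarrow> nat \<Rightarrow> nat red_blue_graph" where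
  "split_graph c p N = \<lparr>points = {..<N},
     edge_colour = (\<lambda>e. if e \<subseteq> {..<p} \<or> e \<subseteq> {p..} then c else (if c = Red then Blue else Red))\<rparr>"

lemma coloured_split_graph:
  "coloured c (split_graph c p N) u v \<longleftrightarrow> (u < p \<longleftrightarrow> v < p)"
  "c \<noteq> d \<Longrightarrow> coloured d (split_graph c p N) u v \<longleftrightarrow> (u < p \<longleftrightarrow> \<not> v < p)"
  by (cases c; cases d; auto simp: split_graph_def)+

lemma split_graph_same_side:
  assumes "contains_copy (mono_subgraph c (split_graph c p N)) (cycle_graph k)"
  shows "k \<le> max p (N - p)"
proof -
  obtain f where f: "inj_on f {..<k}" "f ` {..<k} \<subseteq> {..<N}"
      "\<And>i. i < k \<Longrightarrow> f i < p \<longleftrightarrow> f (Suc i mod k) < p"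
    using contains_copy_cycleE[OF assms] unfolding coloured_split_graph
    by (auto simp: split_graph_def)
  have side: "i < k \<Longrightarrow> f i < p \<longleftrightarrow> f 0 < p" for i
  proof (induction i)
    case (Suc i)
    then show ?case using f(3)[of i] by simp
  qed simp
  have "f ` {..<k} \<subseteq> {..<p} \<or> f ` {..<k} \<subseteq> {p..<N}"
    using side f(2) by (cases "f 0 < p") (fastforce simp: not_less)+
  then have "card (f ` {..<k}) \<le> p \<or> card (f ` {..<k}) \<le> N - p"
    using card_mono[of "{..<p}" "f ` {..<k}"] card_mono[of "{p..<N}" "f ` {..<k}"] by auto
  then show ?thesis using card_image[OF f(1)] by auto
qed

text \<open>Every edge of such a cycle has an end at or above \<open>p\<close>, and each vertex
  there serves two edges.\<close>

lemma split_graph_across: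
  assumes "c \<noteq> d" "contains_copy (mono_subgraph d (split_graph c p N)) (cycle_graph k)"
  shows "k \<le> 2 * (N - p)"
proof -
  obtain f where f: "inj_on f {..<k}" "f ` {..<k} \<subseteq> {..<N}"
      "\<And>i. i < k \<Longrightarrow> f i < p \<longleftrightarrow> \<not> f (Suc i mod k) < p"
    using contains_copy_cycleE[OF assms(2)] unfolding coloured_split_graph(2)[OF assms(1)]
    by (auto simp: split_graph_def)
  let ?P = "{i. i < k \<and> p \<le> f i}" and ?Q = "{i. i < k \<and> p \<le> f (Suc i mod k)}"
  have inj: "inj_on (\<lambda>i. Suc i mod k) {..<k}"
    by (rule inj_onI) (auto simp: mod_Suc split: if_splits)
  have "f ` ?P \<subseteq> {p..<N}" using f(2) by auto
  moreover have "inj_on f ?P" using f(1) by (rule inj_on_subset) auto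
  ultimately have P: "card ?P \<le> N - p"
    using card_inj_on_le[of f ?P "{p..<N}"] by simp
  have "inj_on (\<lambda>i. Suc i mod k) ?Q" using inj by (rule inj_on_subset) auto
  moreover have "(\<lambda>i. Suc i mod k) ` ?Q \<subseteq> ?P" by auto
  ultimately have "card ?Q \<le> card ?P" by (intro card_inj_on_le) auto
  moreover have "{..<k} = ?P \<union> ?Q" using f(3) by fastforce
  then have "k \<le> card ?P + card ?Q" by (metis card_Un_le card_lessThan)
  ultimately show ?thesis using P by linarith
qed

lemma bipartite_split_graph:
  assumes "c \<noteq> d"
  shows "bipartite (mono_subgraph d (split_graph c p N))"
  unfolding bipartite_def
proof (intro exI conjI ballI)
  let ?V = "verts (mono_subgraph d (split_graph c p N))"
  show "?V \<inter> {..<p} \<union> (?V - {..<p}) = ?V" "?V \<inter> {..<p} \<inter> (?V - {..<p}) = {}" by auto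
  fix e assume "e \<in> edges (mono_subgraph d (split_graph c p N))"
  then have e: "e \<in> nsets ?V 2" "edge_colour (split_graph c p N) e = d"
    by (auto simp: mono_subgraph_def)
  then obtain u v where uv: "e = {u, v}" "u \<in> ?V" "v \<in> ?V"
    by (auto simp: nsets_def card_2_iff)
  with e(2) have "u < p \<longleftrightarrow> \<not> v < p"
    using coloured_split_graph(2)[OF assms] by simp
  then show "\<exists>a\<in>?V \<inter> {..<p}. \<exists>b\<in>?V - {..<p}. e = {a, b}"
    using uv by (cases "u < p") (auto simp: insert_commute)
qed

text \<open>The bull: a triangle with pendant edges at two of its vertices, which is self-complementary.
  It makes the case of two four-cycles exceptional.\<close>

definition bull :: "nat \<Rightarrow> nat red_blue_graph" where
  "bull N = \<lparr>points = {..<N},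
     edge_colour = (\<lambda>e. if e \<in> {{0, 1}, {1, 2}, {0, 2}, {0, 3}, {1, 4}} then Red else Blue)\<rparr>"

text \<open>Each vertex of a cycle has two neighbours in its colour. This excludes 3 and 4 from red
  cycles and 0 and 1 from blue ones, leaving three vertices.\<close>

lemma bull_cycle:
  assumes "N \<le> 5" "3 \<le> k" "contains_copy (mono_subgraph c (bull N)) (cycle_graph k)"
  shows "k = 3"
proof -
  obtain f where f: "inj_on f {..<k}" "f ` {..<k} \<subseteq> {..<5}"
      "\<And>i. i < k \<Longrightarrow> coloured c (bull N) (f i) (f (Suc i mod k))"
    using contains_copy_cycleE[OF assms(3)] assms(1)
    by (smt (verit) bull_def lessThan_subset_iff red_blue_graph.select_convs(1) subset_trans)
  have less: "f i < 5" if "i < k" for i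
    using f(2) that by auto
  have nbrs: "\<exists>u w. u < 5 \<and> w < 5 \<and> u \<noteq> w \<and> f i \<noteq> u \<and> f i \<noteq> w
      \<and> coloured c (bull N) (f i) u \<and> coloured c (bull N) (f i) w" if "i < k" for i
  proof -
    define j where "j = (if i = 0 then k - 1 else i - 1)"
    have j: "j < k" "Suc j mod k = i" using that assms(2) by (auto simp: j_def)
    have neq: "j \<noteq> i" "Suc i mod k \<noteq> i" "Suc i mod k \<noteq> j" "Suc i mod k < k"
      using that assms(2) by (auto simp: j_def mod_Suc)
    have "coloured c (bull N) (f i) (f j)" using coloured_sym[OF f(3)[OF j(1)]] j(2) by simp
    moreover have "f j < 5" "f (Suc i mod k) < 5" using less[OF j(1)] less[OF neq(4)] .
    moreover have "f j \<noteq> f (Suc i mod k)" "f i \<noteq> f j" "f i \<noteq> f (Suc i mod k)"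
      using inj_on_eq_iff[OF f(1)] that j(1) neq by auto
    ultimately show ?thesis using f(3)[OF that] by blast
  qed
  have red_pendant: "coloured Red (bull N) 3 u \<Longrightarrow> u = 0" "coloured Red (bull N) 4 u \<Longrightarrow> u = 1" for N u
    by (auto simp: bull_def doubleton_eq_iff split: if_splits)
  have five: "u = 0 \<or> u = 1 \<or> u = 2 \<or> u = 3 \<or> u = 4" if "u < 5" for u :: nat
    using that by linarith
  have blue_pendant: "coloured Blue (bull N) 0 u \<Longrightarrow> u < 5 \<Longrightarrow> 0 \<noteq> u \<Longrightarrow> u = 4"
    "coloured Blue (bull N) 1 u \<Longrightarrow> u < 5 \<Longrightarrow> 1 \<noteq> u \<Longrightarrow> u = 3" for N u
    using five[of u] by (auto simp: bull_def doubleton_eq_iff split: if_splits)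
  have middle: "f i \<in> (if c = Red then {0, 1, 2} else {2, 3, 4})" if "i < k" for i
  proof -
    obtain u w where uw: "u < 5" "w < 5" "u \<noteq> w" "f i \<noteq> u" "f i \<noteq> w"
        "coloured c (bull N) (f i) u" "coloured c (bull N) (f i) w"
      using nbrs[OF \<open>i < k\<close>] by blast
    show ?thesis
    proof (cases c)
      case Red
      then have "f i \<noteq> 3" "f i \<noteq> 4"
        using uw(3,6,7) red_pendant[of N] by metis+
      then show ?thesis using five[OF less[OF that]] Red by auto
    next
      case Blue
      then have "f i \<noteq> 0" "f i \<noteq> 1"
        using uw blue_pendant[of N] by metis+
      then show ?thesis using five[OF less[OF that]] Blue by auto
    qed
  qed
  have "f ` {..<k} \<subseteq> (if c = Red then {0, 1, 2} else {2, 3, 4})"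
    by (rule image_subsetI) (rule middle, simp)
  from card_mono[OF _ this] have "card (f ` {..<k}) \<le> 3"
    by (cases "c = Red") simp_all
  then show ?thesis using card_image[OF f(1)] assms(2) by simp
qed

section \<open>The Ramsey numbers\<close>

definition arrows :: "(nat red_blue_graph \<Rightarrow> bool) \<Rightarrow> nat graph set \<Rightarrow> nat graph set \<Rightarrow> nat \<Rightarrow> bool" where
  "arrows P \<G>\<^sub>1 \<G>\<^sub>2 N \<longleftrightarrow>
     (\<forall>K. finite (points K) \<and> card (points K) = N \<and> P K \<longrightarrow>
        (\<exists>H\<in>\<G>\<^sub>1. contains_copy (red_subgraph K) H) \<or>
        (\<exists>H\<in>\<G>\<^sub>2. contains_copy (blue_subgraph K) H))"

lemma ramsey_within_le:
  "0 < N \<Longrightarrow> arrows P \<G>\<^sub>1 \<G>\<^sub>2 N \<Longrightarrow> ramsey_within P \<G>\<^sub>1 \<G>\<^sub>2 \<le> N"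
  unfolding ramsey_within_def arrows_def by (rule Least_le) blast

text \<open>Some arrowing \<open>N\<close> must be known beforehand to ensure that the
  \<open>LEAST\<close> is attained.\<close>

lemma le_ramsey_within:
  assumes "0 < N" "arrows P \<G>\<^sub>1 \<G>\<^sub>2 N" "\<And>M. M < L \<Longrightarrow> \<not> arrows P \<G>\<^sub>1 \<G>\<^sub>2 M"
  shows "L \<le> ramsey_within P \<G>\<^sub>1 \<G>\<^sub>2"
proof -
  have "arrows P \<G>\<^sub>1 \<G>\<^sub>2 (ramsey_within P \<G>\<^sub>1 \<G>\<^sub>2)"
    using LeastI[of "\<lambda>N. 0 < N \<and> arrows P \<G>\<^sub>1 \<G>\<^sub>2 N" N] assms(1,2)
    unfolding ramsey_within_def arrows_def by blast
  then show ?thesis using assms(3) not_le by blast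
qed

lemma arrows_mono: "arrows (\<lambda>_. True) \<G>\<^sub>1 \<G>\<^sub>2 N \<Longrightarrow> arrows P \<G>\<^sub>1 \<G>\<^sub>2 N"
  by (auto simp: arrows_def)

lemma arrows_even_cycles:
  assumes "cycle_graph (2 * a) \<in> \<G>\<^sub>1" "cycle_graph (2 * b) \<in> \<G>\<^sub>2" "2 \<le> a" "2 \<le> b"
    "N = 2 * max a b + min a b - 1 + (if a = 2 \<and> b = 2 then 1 else 0)"
  shows "arrows (\<lambda>_. True) \<G>\<^sub>1 \<G>\<^sub>2 N"
  unfolding arrows_def
proof (intro allI impI)
  fix K :: "nat red_blue_graph"
  assume K: "finite (points K) \<and> card (points K) = N \<and> True"
  have "has_cycle (coloured Red K) (points K) (2 * a) \<or> has_cycle (coloured Blue K) (points K) (2 * b)"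
  proof (cases "b \<le> a")
    case True
    then have "has_cycle (coloured Red K) (points K) (2 * a) \<or>
        has_cycle (\<lambda>u v. \<not> coloured Red K u v) (points K) (2 * b)"
      using K assms(3-5) coloured_sym by (intro even_cycles_arrow) (auto simp: max_def min_def)
    then show ?thesis using not_coloured[of Red Blue K] by simp
  next
    case False
    then have "has_cycle (coloured Blue K) (points K) (2 * b) \<or>
        has_cycle (\<lambda>u v. \<not> coloured Blue K u v) (points K) (2 * a)"
      using K assms(3-5) coloured_sym by (intro even_cycles_arrow) (auto simp: max_def min_def)
    then show ?thesis using not_coloured[of Blue Red K] by auto
  qed
  then show "(\<exists>H\<in>\<G>\<^sub>1. contains_copy (red_subgraph K) H) \<or> (\<exists>H\<in>\<G>\<^sub>2. contains_copy (blue_subgraph K) H)"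
    using contains_copy_if_has_cycle[of "2 * a" K Red] contains_copy_if_has_cycle[of "2 * b" K Blue]
      assms(1-4) by fastforce
qed

lemma four_cycle_bipartite_graph:
  assumes "bipartite (mono_subgraph c K)" "card (points K) = 5" "c \<noteq> d"
  shows "has_cycle (coloured c K) (points K) 4 \<or> has_cycle (coloured d K) (points K) 4"
proof -
  obtain A B where AB: "A \<union> B = points K" "A \<inter> B = {}"
      "\<And>e. e \<in> edges (mono_subgraph c K) \<Longrightarrow> \<exists>a\<in>A. \<exists>b\<in>B. e = {a, b}"
    using assms(1) by (auto simp: bipartite_def mono_subgraph_def)
  have inside: "\<not> coloured c K u v" if "u \<in> A \<and> v \<in> A \<or> u \<in> B \<and> v \<in> B" "u \<noteq> v" for u v
  proof
    assume "coloured c K u v"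
    then have "{u, v} \<in> edges (mono_subgraph c K)"
      using that AB(1) by (auto simp: mono_subgraph_def nsets_def)
    from AB(3)[OF this] show False
      using that AB(2) by (auto simp: doubleton_eq_iff)
  qed
  have "has_cycle (coloured c K) (A \<union> B) 4 \<or> has_cycle (\<lambda>u v. \<not> coloured c K u v) (A \<union> B) 4"
  proof (rule four_cycle_bipartite[OF _ AB(2)])
    show "card (A \<union> B) = 5" using AB(1) assms(2) by simp
  qed (use inside in \<open>blast intro: coloured_sym\<close>)+
  then show ?thesis unfolding AB(1) not_coloured[OF assms(3)] .
qed

lemma shortest_cycle:
  assumes "\<Gamma> \<noteq> {}" "\<Gamma> \<subseteq> cycles"
  shows "cycle_graph (shortest_cycle_length \<Gamma>) \<in> \<Gamma>" "3 \<le> shortest_cycle_length \<Gamma>"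
    and "\<And>H. H \<in> \<Gamma> \<Longrightarrow> \<exists>k\<ge>shortest_cycle_length \<Gamma>. H = cycle_graph k"
proof -
  obtain k where "3 \<le> k \<and> cycle_graph k \<in> \<Gamma>"
    using assms by (auto simp: cycles_def)
  from LeastI[of "\<lambda>k. 3 \<le> k \<and> cycle_graph k \<in> \<Gamma>", OF this]
  show "cycle_graph (shortest_cycle_length \<Gamma>) \<in> \<Gamma>" "3 \<le> shortest_cycle_length \<Gamma>"
    by (auto simp: shortest_cycle_length_def)
  fix H assume H: "H \<in> \<Gamma>"
  then obtain k where "3 \<le> k" "H = cycle_graph k"
    using assms(2) by (auto simp: cycles_def)
  moreover from this H have "shortest_cycle_length \<Gamma> \<le> k"
    unfolding shortest_cycle_length_def by (intro Least_le) auto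
  ultimately show "\<exists>k\<ge>shortest_cycle_length \<Gamma>. H = cycle_graph k" by blast
qed

theorem corollary1p9:
  fixes \<Gamma>\<^sub>1 \<Gamma>\<^sub>2 :: "nat graph set"
  assumes "\<Gamma>\<^sub>1 \<noteq> {}" and "\<Gamma>\<^sub>1 \<subseteq> cycles"
    and "\<Gamma>\<^sub>2 \<noteq> {}" and "\<Gamma>\<^sub>2 \<subseteq> cycles"
    and "even (shortest_cycle_length \<Gamma>\<^sub>1)"
    and "even (shortest_cycle_length \<Gamma>\<^sub>2)"
  shows "ramsey \<Gamma>\<^sub>1 \<Gamma>\<^sub>2 = (if (\<Gamma>\<^sub>1, \<Gamma>\<^sub>2) \<in> \<C> then \<mm> \<Gamma>\<^sub>1 \<Gamma>\<^sub>2 + 1 else \<mm> \<Gamma>\<^sub>1 \<Gamma>\<^sub>2)"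
proof -
  note S1 = shortest_cycle[OF assms(1,2)] and S2 = shortest_cycle[OF assms(3,4)]
  obtain a b where ab: "shortest_cycle_length \<Gamma>\<^sub>1 = 2 * a" "shortest_cycle_length \<Gamma>\<^sub>2 = 2 * b"
    using assms(5,6) by (auto elim!: evenE)
  have ab2: "2 \<le> a" "2 \<le> b" using S1(2) S2(2) ab by auto
  \<comment> \<open>\<open>L\<close> will be the value of \<open>\<mm>\<close> and \<open>N\<close>
    the Ramsey number; they differ only if both shortest cycles are four-cycles.\<close>
  define L where "L = 2 * max a b + min a b - 1"
  define N where "N = L + (if a = 2 \<and> b = 2 then 1 else 0)"
  have "0 < N" "0 < L" using ab2 by (auto simp: N_def L_def)
  have arr: "arrows P \<Gamma>\<^sub>1 \<Gamma>\<^sub>2 N" for P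
    by (rule arrows_mono, rule arrows_even_cycles[of a _ b])
      (use S1(1) S2(1) ab ab2 in \<open>auto simp: N_def L_def\<close>)
  have split: "\<not> arrows P \<Gamma>\<^sub>1 \<Gamma>\<^sub>2 M"
    if "M < L" "P = (if b \<le> a then blue_bipartite else red_bipartite)" for M P
  proof -
    define c where "c = (if b \<le> a then Red else Blue)"
    define p where "p = 2 * max a b - 1"
    let ?K = "split_graph c p M"
    have P: "P ?K"
      using that(2) bipartite_split_graph[of c _ p M]
      by (auto simp: c_def blue_bipartite_def red_bipartite_def)
    \<comment> \<open>\<open>M < L\<close> leaves fewer than \<open>min a b\<close> vertices beyond
      \<open>p\<close>, so cycles across are shorter than \<open>2 * min a b\<close>, and those
      within one side are shorter than \<open>2 * max a b\<close>.\<close>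
    have Mp: "M - p < min a b" "p < 2 * max a b" "M - p < 2 * max a b"
      using that(1) ab2 by (auto simp: L_def p_def max_def min_def)
    have "\<not> contains_copy (red_subgraph ?K) (cycle_graph k)" if "2 * a \<le> k" for k
      using that Mp split_graph_same_side[of Red p M k] split_graph_across[of Blue Red p M k]
      by (auto simp: c_def max_def min_def split: if_splits)
    moreover have "\<not> contains_copy (blue_subgraph ?K) (cycle_graph k)" if "2 * b \<le> k" for k
      using that Mp split_graph_same_side[of Blue p M k] split_graph_across[of Red Blue p M k]
      by (auto simp: c_def max_def min_def split: if_splits)
    ultimately have "\<not> (\<exists>H\<in>\<Gamma>\<^sub>1. contains_copy (red_subgraph ?K) H)"
      "\<not> (\<exists>H\<in>\<Gamma>\<^sub>2. contains_copy (blue_subgraph ?K) H)"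
      using S1(3) S2(3) ab by metis+
    moreover have "finite (points ?K)" "card (points ?K) = M" by (simp_all add: split_graph_def)
    ultimately show ?thesis using P unfolding arrows_def by blast
  qed
  have lower: "L \<le> \<mm> \<Gamma>\<^sub>1 \<Gamma>\<^sub>2"
    using le_ramsey_within[OF \<open>0 < N\<close> arr split]
    unfolding \<mm>_def ramsey_red_def ramsey_blue_def by (cases "b \<le> a") (auto simp: le_max_iff_disj)
  have upper: "\<mm> \<Gamma>\<^sub>1 \<Gamma>\<^sub>2 \<le> L"
  proof -
    \<comment> \<open>Two four-cycles need only five vertices once a colour is bipartite; in all
      other cases \<open>N = L\<close>.\<close>
    have "arrows P \<Gamma>\<^sub>1 \<Gamma>\<^sub>2 L" if P: "P = red_bipartite \<or> P = blue_bipartite" for P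
    proof (cases "a = 2 \<and> b = 2")
      case True
      show ?thesis
        unfolding arrows_def
      proof (intro allI impI)
        fix K assume K: "finite (points K) \<and> card (points K) = L \<and> P K"
        then have "has_cycle (coloured Red K) (points K) 4 \<or> has_cycle (coloured Blue K) (points K) 4"
          using P True four_cycle_bipartite_graph[of Red K Blue] four_cycle_bipartite_graph[of Blue K Red]
          by (auto simp: L_def red_bipartite_def blue_bipartite_def)
        then show "(\<exists>H\<in>\<Gamma>\<^sub>1. contains_copy (red_subgraph K) H) \<or> (\<exists>H\<in>\<Gamma>\<^sub>2. contains_copy (blue_subgraph K) H)"
          using contains_copy_if_has_cycle[of 4] S1(1) S2(1) ab True by fastforce
      qed
    next
      case False
      then have "N = L" by (simp add: N_def)
      then show ?thesis using arr by metis
    qed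
    then show ?thesis
      using ramsey_within_le[OF \<open>0 < L\<close>] unfolding \<mm>_def ramsey_red_def ramsey_blue_def by simp
  qed
  have "ramsey \<Gamma>\<^sub>1 \<Gamma>\<^sub>2 \<le> N"
    unfolding ramsey_def using \<open>0 < N\<close> arr by (rule ramsey_within_le)
  moreover have "N \<le> ramsey \<Gamma>\<^sub>1 \<Gamma>\<^sub>2"
    unfolding ramsey_def
  proof (rule le_ramsey_within[OF \<open>0 < N\<close> arr])
    fix M assume M: "M < N"
    show "\<not> arrows (\<lambda>_. True) \<Gamma>\<^sub>1 \<Gamma>\<^sub>2 M"
    proof (cases "a = 2 \<and> b = 2")
      case True
      then have "M \<le> 5" using M by (simp add: N_def L_def)
      then have "\<not> contains_copy (mono_subgraph c (bull M)) (cycle_graph k)" if "4 \<le> k" for c k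
        using bull_cycle[of M k c] that by auto
      then have "\<not> (\<exists>H\<in>\<Gamma>\<^sub>1. contains_copy (red_subgraph (bull M)) H)"
        "\<not> (\<exists>H\<in>\<Gamma>\<^sub>2. contains_copy (blue_subgraph (bull M)) H)"
        using S1(3) S2(3) ab True by fastforce+
      moreover have "finite (points (bull M))" "card (points (bull M)) = M"
        by (simp_all add: bull_def)
      ultimately show ?thesis unfolding arrows_def by blast
    next
      case False
      then have "M < L" using M by (auto simp: N_def split: if_splits)
      then show ?thesis using split arrows_mono by blast
    qed
  qed
  \<comment> \<open>Neither set contains a triangle, so the second condition in \<open>\<C>\<close>
    holds and the first asks for \<open>cycle_graph 4\<close> in both sets.\<close>
  moreover have "(\<Gamma>\<^sub>1, \<Gamma>\<^sub>2) \<in> \<C> \<longleftrightarrow> a = 2 \<and> b = 2"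
  proof -
    have least: "shortest_cycle_length \<Gamma> \<le> k" if "cycle_graph k \<in> \<Gamma>" "3 \<le> k" for \<Gamma> k
      unfolding shortest_cycle_length_def using that by (intro Least_le) auto
    have "cycle_graph 3 \<notin> \<Gamma>\<^sub>1" "cycle_graph 3 \<notin> \<Gamma>\<^sub>2"
      using least[of 3 \<Gamma>\<^sub>1] least[of 3 \<Gamma>\<^sub>2] ab ab2 by auto
    moreover have "cycle_graph 4 \<in> \<Gamma>\<^sub>1 \<longleftrightarrow> a = 2" "cycle_graph 4 \<in> \<Gamma>\<^sub>2 \<longleftrightarrow> b = 2"
      using least[of 4 \<Gamma>\<^sub>1] least[of 4 \<Gamma>\<^sub>2] S1(1) S2(1) ab ab2 by auto
    ultimately show ?thesis using assms(1-4) by (auto simp: \<C>_def)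
  qed
  ultimately show ?thesis using lower upper by (auto simp: N_def)
qed

end
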